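(* Let $\mathcal{C}$ be a spherical tensor category over $k$, let $A\in\mathcal{C}$ be a separable connected algebra, and let $H$ be a Hopf algebra over $k$ (in vector spaces) acting faithfully on $A$. Then there is an algebra epimorphism $\gamma\colon Q(A)\to H^*$ from the convolution algebra of $A$ to the dual algebra of $H$. In particular, $H^*$ is a quotient of $Q(A)$.
   Context: $k$ is an algebraically closed field of characteristic zero. A tensor category is a $k$-linear abelian monoidal category with $k$-linear tensor product whose unit object $I$ is simple, in particular $\mathcal{C}(I,I)\cong k$; $\mathcal{C}(X,Y)$ denotes the hom-space. In a spherical tensor category write $\mathrm{ev}_X\colon X^*\otimes X\to I$, $\mathrm{coev}_X\colon I\to X\otimes X^*$ for evaluation and coevaluation and $s_X\colon X\to X^{**}$ for the spherical structure (associativity and unit isomorphisms are suppressed). Algebras $A=(A,m,\iota)$ in $\mathcal{C}$ are associative and unital. The canonical trace of $A$ is $\varepsilon=\mathrm{ev}_{A^*}\circ(s_A\otimes 1)\circ(m\otimes 1)\circ(1\otimes\mathrm{coev}_A)\colon A\to I$, and the canonical pairing is $b=\varepsilon\circ m\colon A\otimes A\to I$. $A$ is separable if $b$ is non-degenerate, i.e. there is $\kappa\colon I\to A\otimes A$ with $(b\otimes 1)\circ(1\otimes\kappa)=1_A$ (then also $(1\otimes b)\circ(\kappa\otimes 1)=1_A$). $A$ is connected if $\mathcal{C}(I,A)=k$ (spanned by $\iota$). For a separable algebra $A$, let $m^\vee\colon A\to A\otimes A$ be the morphism dual to $m$ under the self-duality of $A$ given by $b$, i.e. $m^\vee=(m\otimes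 1)\circ(1\otimes\kappa)$. The convolution algebra $Q(A)$ is the vector space $\mathcal{C}(A,A)$ with multiplication $x*y=m\circ(x\otimes y)\circ m^\vee$ and unit $\iota\circ\varepsilon$. An action of a bialgebra $H$ (over $k$, with coproduct $\delta(h)=\sum_{(h)}h_{(0)}\otimes h_{(1)}$ and counit $\varepsilon_H$) on $A$ is a morphism $H\otimes A\to A$, equivalently a linear map $\rho\colon H\to\mathcal{C}(A,A)$, such that: $\rho$ is a unital algebra homomorphism with respect to composition on $\mathcal{C}(A,A)$; $\rho(h)\circ m=\sum_{(h)}m\circ(\rho(h_{(0)})\otimes\rho(h_{(1)}))$; and $\rho(h)\circ\iota=\varepsilon_H(h)\,\iota$ for all $h\in H$. The action is faithful if $\rho$ is injective. The dual $H^*$ has multiplication $(l\cdot m)(h)=\sum_{(h)}l(h_{(0)})\,m(h_{(1)})$ for $h\in H$, $l,m\in H^*$.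
   Formalization: It is additionally assumed that the hom-space C(A,A) or the Hopf algebra H is finite-dimensional (automatic if C has finite-dimensional hom-spaces); without this H* can be too large to be a quotient of Q(A). *)

theory Defs
  imports "HOL-Computational_Algebra.Polynomial" "HOL-Algebra.Module"
begin

section \<open>Linear and abelian categories\<close>

text \<open>The objects are the elements of the type \<open>'o\<close> and the morphisms are the elements of \<open>'m\<close>, each
  morphism having one source and one target. The operations on morphisms are total functions that are
  meaningful on composable (or parallel) arguments only.\<close>

record ('o, 'm, 'k) linear_category_data =
  source :: "'m \<Rightarrow> 'o"
  target :: "'m \<Rightarrow> 'o"
  ident :: "'o \<Rightarrow> 'm"
  compose :: "'m \<Rightarrow> 'm \<Rightarrow> 'm"  (infixl \<open>\<cdot>\<index>\<close> 70)
  zero_mor :: "'o \<Rightarrow> 'o \<Rightarrow> 'm"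
  plus_mor :: "'m \<Rightarrow> 'm \<Rightarrow> 'm"  (infixl \<open>\<boxplus>\<index>\<close> 65)
  scale_mor :: "'k \<Rightarrow> 'm \<Rightarrow> 'm"  (infixr \<open>\<bullet>\<index>\<close> 73)

definition ground_ring :: "'k::field ring"
  where "ground_ring = \<lparr>carrier = UNIV, mult = (*), one = 1, zero = 0, add = (+)\<rparr>"

context
  fixes C :: "('o, 'm, 'k::field, 'z) linear_category_data_scheme" (structure)
begin

definition hom_set :: "'o \<Rightarrow> 'o \<Rightarrow> 'm set"
  where "hom_set X Y = {f. source C f = X \<and> target C f = Y}"

text \<open>The vector space of morphisms \<open>X \<rightarrow> Y\<close>; the multiplicative fields of the record are not used.\<close>

definition hom_space :: "'o \<Rightarrow> 'o \<Rightarrow> ('k, 'm) module"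
  where "hom_space X Y =
    \<lparr>carrier = hom_set X Y, mult = undefined, one = undefined,
     zero = zero_mor C X Y, add = (\<boxplus>), smult = (\<bullet>)\<rparr>"

definition inverse_mors :: "'m \<Rightarrow> 'm \<Rightarrow> bool"
  where "inverse_mors f g \<longleftrightarrow>
    g \<in> hom_set (target C f) (source C f) \<and>
    g \<cdot> f = ident C (source C f) \<and> f \<cdot> g = ident C (target C f)"

definition iso_mor :: "'m \<Rightarrow> bool"
  where "iso_mor f \<longleftrightarrow> (\<exists>g. inverse_mors f g)"

definition inv_mor :: "'m \<Rightarrow> 'm"
  where "inv_mor f = (THE g. inverse_mors f g)"

definition mono_mor :: "'m \<Rightarrow> bool"
  where "mono_mor f \<longleftrightarrow>
    (\<forall>W. \<forall>g\<in>hom_set W (source C f). \<forall>h\<in>hom_set W (source C f). f \<cdot> g = f \<cdot> h \<longrightarrow> g = h)"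

definition epi_mor :: "'m \<Rightarrow> bool"
  where "epi_mor f \<longleftrightarrow>
    (\<forall>W. \<forall>g\<in>hom_set (target C f) W. \<forall>h\<in>hom_set (target C f) W. g \<cdot> f = h \<cdot> f \<longrightarrow> g = h)"

definition zero_object :: "'o \<Rightarrow> bool"
  where "zero_object Z \<longleftrightarrow> (\<forall>X. (\<exists>!f. f \<in> hom_set X Z) \<and> (\<exists>!f. f \<in> hom_set Z X))"

definition kernel_of :: "'m \<Rightarrow> 'm \<Rightarrow> bool"
  where "kernel_of f i \<longleftrightarrow>
    target C i = source C f \<and> f \<cdot> i = zero_mor C (source C i) (target C f) \<and>
    (\<forall>W. \<forall>g\<in>hom_set W (source C f).
       f \<cdot> g = zero_mor C W (target C f) \<longrightarrow> (\<exists>!u. u \<in> hom_set W (source C i) \<and> i \<cdot> u = g))"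

definition cokernel_of :: "'m \<Rightarrow> 'm \<Rightarrow> bool"
  where "cokernel_of f p \<longleftrightarrow>
    source C p = target C f \<and> p \<cdot> f = zero_mor C (source C f) (target C p) \<and>
    (\<forall>W. \<forall>g\<in>hom_set (target C f) W.
       g \<cdot> f = zero_mor C (source C f) W \<longrightarrow> (\<exists>!u. u \<in> hom_set (target C p) W \<and> u \<cdot> p = g))"

definition biproduct :: "'o \<Rightarrow> 'o \<Rightarrow> 'o \<Rightarrow> bool"
  where "biproduct X Y P \<longleftrightarrow>
    (\<exists>i\<in>hom_set X P. \<exists>j\<in>hom_set Y P. \<exists>p\<in>hom_set P X. \<exists>q\<in>hom_set P Y.
       p \<cdot> i = ident C X \<and> q \<cdot> j = ident C Y \<and>
       p \<cdot> j = zero_mor C Y X \<and> q \<cdot> i = zero_mor C X Y \<and>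
       (i \<cdot> p) \<boxplus> (j \<cdot> q) = ident C P)"

end

locale k_linear_category =
  fixes C :: "('o, 'm, 'k::field, 'z) linear_category_data_scheme" (structure)
  assumes ident_hom: "ident C X \<in> hom_set C X X"
    and compose_hom: "\<lbrakk>f \<in> hom_set C X Y; g \<in> hom_set C Y Z\<rbrakk> \<Longrightarrow> g \<cdot> f \<in> hom_set C X Z"
    and compose_assoc:
      "\<lbrakk>f \<in> hom_set C W X; g \<in> hom_set C X Y; h \<in> hom_set C Y Z\<rbrakk> \<Longrightarrow> h \<cdot> g \<cdot> f = h \<cdot> (g \<cdot> f)"
    and compose_ident_left: "f \<in> hom_set C X Y \<Longrightarrow> ident C Y \<cdot> f = f"
    and compose_ident_right: "f \<in> hom_set C X Y \<Longrightarrow> f \<cdot> ident C X = f"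
    and hom_vector_space: "Module.module ground_ring (hom_space C X Y)"
    and compose_plus_left:
      "\<lbrakk>f \<in> hom_set C X Y; g \<in> hom_set C Y Z; h \<in> hom_set C Y Z\<rbrakk> \<Longrightarrow>
        (g \<boxplus> h) \<cdot> f = (g \<cdot> f) \<boxplus> (h \<cdot> f)"
    and compose_plus_right:
      "\<lbrakk>f \<in> hom_set C X Y; g \<in> hom_set C X Y; h \<in> hom_set C Y Z\<rbrakk> \<Longrightarrow>
        h \<cdot> (f \<boxplus> g) = (h \<cdot> f) \<boxplus> (h \<cdot> g)"
    and compose_scale_left:
      "\<lbrakk>f \<in> hom_set C X Y; g \<in> hom_set C Y Z\<rbrakk> \<Longrightarrow> (c \<bullet> g) \<cdot> f = c \<bullet> (g \<cdot> f)"
    and compose_scale_right: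
      "\<lbrakk>f \<in> hom_set C X Y; g \<in> hom_set C Y Z\<rbrakk> \<Longrightarrow> g \<cdot> (c \<bullet> f) = c \<bullet> (g \<cdot> f)"

locale k_linear_abelian_category = k_linear_category +
  assumes ex_zero_object: "\<exists>Z. zero_object C Z"
    and ex_biproduct: "\<exists>P. biproduct C X Y P"
    and ex_kernel: "\<exists>i. kernel_of C f i"
    and ex_cokernel: "\<exists>p. cokernel_of C f p"
    and mono_is_kernel: "mono_mor C i \<Longrightarrow> \<exists>f. kernel_of C f i"
    and epi_is_cokernel: "epi_mor C p \<Longrightarrow> \<exists>f. cokernel_of C f p"

section \<open>Spherical tensor categories\<close>

record ('o, 'm, 'k) monoidal_data = "('o, 'm, 'k) linear_category_data" +
  tensor_ob :: "'o \<Rightarrow> 'o \<Rightarrow> 'o"  (infixr \<open>\<boxtimes>\<index>\<close> 75)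
  tensor_mor :: "'m \<Rightarrow> 'm \<Rightarrow> 'm"  (infixr \<open>\<star>\<index>\<close> 75)
  unit_ob :: 'o
  associator :: "'o \<Rightarrow> 'o \<Rightarrow> 'o \<Rightarrow> 'm"
  lunitor :: "'o \<Rightarrow> 'm"
  runitor :: "'o \<Rightarrow> 'm"

locale tensor_category = k_linear_abelian_category C
  for C :: "('o, 'm, 'k::field, 'z) monoidal_data_scheme" (structure) +
  assumes tensor_hom:
      "\<lbrakk>f \<in> hom_set C X X'; g \<in> hom_set C Y Y'\<rbrakk> \<Longrightarrow> f \<star> g \<in> hom_set C (X \<boxtimes> Y) (X' \<boxtimes> Y')"
    and tensor_ident: "ident C X \<star> ident C Y = ident C (X \<boxtimes> Y)"
    and tensor_compose:
      "\<lbrakk>f \<in> hom_set C X X'; f' \<in> hom_set C X' X''; g \<in> hom_set C Y Y'; g' \<in> hom_set C Y' Y''\<rbrakk> \<Longrightarrow>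
        (f' \<cdot> f) \<star> (g' \<cdot> g) = (f' \<star> g') \<cdot> (f \<star> g)"
    and tensor_plus_left:
      "\<lbrakk>f \<in> hom_set C X X'; f' \<in> hom_set C X X'; g \<in> hom_set C Y Y'\<rbrakk> \<Longrightarrow>
        (f \<boxplus> f') \<star> g = (f \<star> g) \<boxplus> (f' \<star> g)"
    and tensor_plus_right:
      "\<lbrakk>f \<in> hom_set C X X'; g \<in> hom_set C Y Y'; g' \<in> hom_set C Y Y'\<rbrakk> \<Longrightarrow>
        f \<star> (g \<boxplus> g') = (f \<star> g) \<boxplus> (f \<star> g')"
    and tensor_scale_left:
      "\<lbrakk>f \<in> hom_set C X X'; g \<in> hom_set C Y Y'\<rbrakk> \<Longrightarrow> (c \<bullet> f) \<star> g = c \<bullet> (f \<star> g)"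
    and tensor_scale_right:
      "\<lbrakk>f \<in> hom_set C X X'; g \<in> hom_set C Y Y'\<rbrakk> \<Longrightarrow> f \<star> (c \<bullet> g) = c \<bullet> (f \<star> g)"
    and associator_hom:
      "associator C X Y Z \<in> hom_set C ((X \<boxtimes> Y) \<boxtimes> Z) (X \<boxtimes> (Y \<boxtimes> Z))"
    and associator_iso: "iso_mor C (associator C X Y Z)"
    and associator_natural:
      "\<lbrakk>f \<in> hom_set C X X'; g \<in> hom_set C Y Y'; h \<in> hom_set C Z Z'\<rbrakk> \<Longrightarrow>
        associator C X' Y' Z' \<cdot> ((f \<star> g) \<star> h) = (f \<star> (g \<star> h)) \<cdot> associator C X Y Z"
    and lunitor_hom: "lunitor C X \<in> hom_set C (unit_ob C \<boxtimes> X) X"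
    and lunitor_iso: "iso_mor C (lunitor C X)"
    and lunitor_natural:
      "f \<in> hom_set C X Y \<Longrightarrow> lunitor C Y \<cdot> (ident C (unit_ob C) \<star> f) = f \<cdot> lunitor C X"
    and runitor_hom: "runitor C X \<in> hom_set C (X \<boxtimes> unit_ob C) X"
    and runitor_iso: "iso_mor C (runitor C X)"
    and runitor_natural:
      "f \<in> hom_set C X Y \<Longrightarrow> runitor C Y \<cdot> (f \<star> ident C (unit_ob C)) = f \<cdot> runitor C X"
    and pentagon:
      "associator C W X (Y \<boxtimes> Z) \<cdot> associator C (W \<boxtimes> X) Y Z =
        (ident C W \<star> associator C X Y Z) \<cdot> associator C W (X \<boxtimes> Y) Z \<cdot>
        (associator C W X Y \<star> ident C Z)"
    and triangle:
      "(ident C X \<star> lunitor C Y) \<cdot> associator C X (unit_ob C) Y = runitor C X \<star> ident C Y"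
    and unit_nonzero: "\<not> zero_object C (unit_ob C)"
    and unit_simple:
      "\<lbrakk>f \<in> hom_set C X (unit_ob C); mono_mor C f\<rbrakk> \<Longrightarrow> zero_object C X \<or> iso_mor C f"
    and unit_endo: "f \<in> hom_set C (unit_ob C) (unit_ob C) \<Longrightarrow> \<exists>c. f = c \<bullet> ident C (unit_ob C)"

record ('o, 'm, 'k) spherical_data = "('o, 'm, 'k) monoidal_data" +
  dual_ob :: "'o \<Rightarrow> 'o"
  ev :: "'o \<Rightarrow> 'm"
  coev :: "'o \<Rightarrow> 'm"
  sph :: "'o \<Rightarrow> 'm"

context
  fixes C :: "('o, 'm, 'k::field, 'z) spherical_data_scheme" (structure)
begin

text \<open>The adjoint \<open>U \<rightarrow> X\<^sup>*\<close> of a morphism \<open>p : U \<otimes> X \<rightarrow> I\<close>.\<close>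

definition transpose_mor :: "'o \<Rightarrow> 'o \<Rightarrow> 'm \<Rightarrow> 'm"
  where "transpose_mor U X p =
    lunitor C (dual_ob C X) \<cdot> (p \<star> ident C (dual_ob C X)) \<cdot>
    inv_mor C (associator C U X (dual_ob C X)) \<cdot>
    (ident C U \<star> coev C X) \<cdot> inv_mor C (runitor C U)"

definition dual_mor :: "'m \<Rightarrow> 'm"
  where "dual_mor f =
    transpose_mor (dual_ob C (target C f)) (source C f)
      (ev C (target C f) \<cdot> (ident C (dual_ob C (target C f)) \<star> f))"

text \<open>The canonical morphisms \<open>Y\<^sup>* \<otimes> X\<^sup>* \<rightarrow> (X \<otimes> Y)\<^sup>*\<close> and \<open>I \<rightarrow> I\<^sup>*\<close>.\<close>

definition dual_tensor :: "'o \<Rightarrow> 'o \<Rightarrow> 'm"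
  where "dual_tensor X Y =
    (let X' = dual_ob C X; Y' = dual_ob C Y in
     transpose_mor (Y' \<boxtimes> X') (X \<boxtimes> Y)
       (ev C Y \<cdot> (ident C Y' \<star> lunitor C Y) \<cdot> (ident C Y' \<star> (ev C X \<star> ident C Y)) \<cdot>
        (ident C Y' \<star> inv_mor C (associator C X' X Y)) \<cdot> associator C Y' X' (X \<boxtimes> Y)))"

definition dual_unit :: 'm
  where "dual_unit = transpose_mor (unit_ob C) (unit_ob C) (lunitor C (unit_ob C))"

definition right_trace :: "'o \<Rightarrow> 'm \<Rightarrow> 'm"
  where "right_trace X f =
    ev C (dual_ob C X) \<cdot> ((sph C X \<cdot> f) \<star> ident C (dual_ob C X)) \<cdot> coev C X"

definition left_trace :: "'o \<Rightarrow> 'm \<Rightarrow> 'm"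
  where "left_trace X f =
    ev C X \<cdot> (ident C (dual_ob C X) \<star> (f \<cdot> inv_mor C (sph C X))) \<cdot> coev C (dual_ob C X)"

end

text \<open>\<open>sph_tensor\<close> and \<open>sph_unit\<close> say that the isomorphism \<open>sph : Id \<rightarrow> (-)\<^sup>*\<^sup>*\<close> is monoidal. The
  structure isomorphism \<open>X\<^sup>*\<^sup>* \<otimes> Y\<^sup>*\<^sup>* \<rightarrow> (X \<otimes> Y)\<^sup>*\<^sup>*\<close> of the double dual is \<open>dual_tensor\<close> for \<open>Y\<^sup>*, X\<^sup>*\<close>
  followed by the inverse of the dual of \<open>dual_tensor\<close> for \<open>X, Y\<close>; the inverse has been moved to the
  other side of the equation, and likewise for the unit.\<close>

locale spherical_tensor_category = tensor_category C
  for C :: "('o, 'm, 'k::field, 'z) spherical_data_scheme" (structure) +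
  assumes ev_hom: "ev C X \<in> hom_set C (dual_ob C X \<boxtimes> X) (unit_ob C)"
    and coev_hom: "coev C X \<in> hom_set C (unit_ob C) (X \<boxtimes> dual_ob C X)"
    and zigzag_ob:
      "runitor C X \<cdot> (ident C X \<star> ev C X) \<cdot> associator C X (dual_ob C X) X \<cdot>
       (coev C X \<star> ident C X) \<cdot> inv_mor C (lunitor C X) = ident C X"
    and zigzag_dual:
      "lunitor C (dual_ob C X) \<cdot> (ev C X \<star> ident C (dual_ob C X)) \<cdot>
       inv_mor C (associator C (dual_ob C X) X (dual_ob C X)) \<cdot>
       (ident C (dual_ob C X) \<star> coev C X) \<cdot> inv_mor C (runitor C (dual_ob C X)) =
       ident C (dual_ob C X)"
    and sph_hom: "sph C X \<in> hom_set C X (dual_ob C (dual_ob C X))"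
    and sph_iso: "iso_mor C (sph C X)"
    and sph_natural:
      "f \<in> hom_set C X Y \<Longrightarrow> sph C Y \<cdot> f = dual_mor C (dual_mor C f) \<cdot> sph C X"
    and sph_tensor:
      "dual_mor C (dual_tensor C X Y) \<cdot> sph C (X \<boxtimes> Y) =
       dual_tensor C (dual_ob C Y) (dual_ob C X) \<cdot> (sph C X \<star> sph C Y)"
    and sph_unit: "dual_mor C (dual_unit C) \<cdot> sph C (unit_ob C) = dual_unit C"
    and spherical: "f \<in> hom_set C X X \<Longrightarrow> left_trace C X f = right_trace C X f"

section \<open>Separable algebras and the convolution algebra\<close>

context
  fixes C :: "('o, 'm, 'k::field, 'z) spherical_data_scheme" (structure)
begin

definition algebra_in :: "'o \<Rightarrow> 'm \<Rightarrow> 'm \<Rightarrow> bool"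
  where "algebra_in A m \<iota> \<longleftrightarrow>
    m \<in> hom_set C (A \<boxtimes> A) A \<and> \<iota> \<in> hom_set C (unit_ob C) A \<and>
    m \<cdot> (m \<star> ident C A) = m \<cdot> (ident C A \<star> m) \<cdot> associator C A A A \<and>
    m \<cdot> (\<iota> \<star> ident C A) = lunitor C A \<and>
    m \<cdot> (ident C A \<star> \<iota>) = runitor C A"

definition connected_algebra :: "'o \<Rightarrow> 'm \<Rightarrow> bool"
  where "connected_algebra A \<iota> \<longleftrightarrow>
    \<iota> \<noteq> zero_mor C (unit_ob C) A \<and> hom_set C (unit_ob C) A = range (\<lambda>c. c \<bullet> \<iota>)"

definition canonical_trace :: "'o \<Rightarrow> 'm \<Rightarrow> 'm"
  where "canonical_trace A m =
    ev C (dual_ob C A) \<cdot> (sph C A \<star> ident C (dual_ob C A)) \<cdot> (m \<star> ident C (dual_ob C A)) \<cdot>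
    inv_mor C (associator C A A (dual_ob C A)) \<cdot> (ident C A \<star> coev C A) \<cdot> inv_mor C (runitor C A)"

definition canonical_pairing :: "'o \<Rightarrow> 'm \<Rightarrow> 'm"
  where "canonical_pairing A m = canonical_trace A m \<cdot> m"

definition copairing :: "'o \<Rightarrow> 'm \<Rightarrow> 'm \<Rightarrow> bool"
  where "copairing A m \<kappa> \<longleftrightarrow>
    \<kappa> \<in> hom_set C (unit_ob C) (A \<boxtimes> A) \<and>
    lunitor C A \<cdot> (canonical_pairing A m \<star> ident C A) \<cdot> inv_mor C (associator C A A A) \<cdot>
    (ident C A \<star> \<kappa>) \<cdot> inv_mor C (runitor C A) = ident C A"

definition separable_algebra :: "'o \<Rightarrow> 'm \<Rightarrow> 'm \<Rightarrow> bool"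
  where "separable_algebra A m \<iota> \<longleftrightarrow> algebra_in A m \<iota> \<and> (\<exists>\<kappa>. copairing A m \<kappa>)"

text \<open>The copairing of a separable algebra is unique, so that the choice below is immaterial.\<close>

definition kappa :: "'o \<Rightarrow> 'm \<Rightarrow> 'm"
  where "kappa A m = (SOME \<kappa>. copairing A m \<kappa>)"

definition dual_mult :: "'o \<Rightarrow> 'm \<Rightarrow> 'm"
  where "dual_mult A m =
    (m \<star> ident C A) \<cdot> inv_mor C (associator C A A A) \<cdot> (ident C A \<star> kappa A m) \<cdot>
    inv_mor C (runitor C A)"

definition convolution_algebra :: "'o \<Rightarrow> 'm \<Rightarrow> 'm \<Rightarrow> ('k, 'm) module"
  where "convolution_algebra A m \<iota> =
    (hom_space C A A)
      \<lparr>mult := \<lambda>x y. m \<cdot> (x \<star> y) \<cdot> dual_mult A m,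
       one := \<iota> \<cdot> canonical_trace A m\<rparr>"

end

definition finite_dim_module :: "('k::field, 'm) module \<Rightarrow> bool"
  where "finite_dim_module M \<longleftrightarrow>
    (\<exists>B. finite B \<and> B \<subseteq> carrier M \<and>
      (\<forall>x\<in>carrier M. \<exists>c. x = (\<Oplus>\<^bsub>M\<^esub>b\<in>B. c b \<odot>\<^bsub>M\<^esub> b)))"

section \<open>Hopf algebras\<close>

text \<open>Elements of the tensor powers of a vector space (type \<open>'h\<close>, scalar multiplication \<open>scale\<close>) are
  represented by formal sums of words; \<open>[[a, b], [c, d]]\<close> stands for \<open>a \<otimes> b + c \<otimes> d\<close>. Two formal sums
  represent the same tensor iff they are related by the congruence generated by the defining
  relations of the tensor product.\<close>

inductive tensor_eq :: "('k::field \<Rightarrow> 'h::ab_group_add \<Rightarrow> 'h) \<Rightarrow> 'h list list \<Rightarrow> 'h list list \<Rightarrow> bool"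
  for scale
  where
    refl: "tensor_eq scale s s"
  | sym: "tensor_eq scale s t \<Longrightarrow> tensor_eq scale t s"
  | trans: "tensor_eq scale s t \<Longrightarrow> tensor_eq scale t u \<Longrightarrow> tensor_eq scale s u"
  | append: "tensor_eq scale s s' \<Longrightarrow> tensor_eq scale t t' \<Longrightarrow> tensor_eq scale (s @ t) (s' @ t')"
  | commute: "tensor_eq scale (s @ t) (t @ s)"
  | zero: "tensor_eq scale [u @ [0] @ v] []"
  | plus: "tensor_eq scale [u @ [a + b] @ v] [u @ [a] @ v, u @ [b] @ v]"
  | scale: "tensor_eq scale [u @ [scale c a] @ v @ [b] @ w] [u @ [a] @ v @ [scale c b] @ w]"

abbreviation tensor2_eq ::
    "('k::field \<Rightarrow> 'h::ab_group_add \<Rightarrow> 'h) \<Rightarrow> ('h \<times> 'h) list \<Rightarrow> ('h \<times> 'h) list \<Rightarrow> bool"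
  where "tensor2_eq scale s t \<equiv> tensor_eq scale [[a, b]. (a, b) \<leftarrow> s] [[a, b]. (a, b) \<leftarrow> t]"

text \<open>The list \<open>\<delta> h\<close> is a chosen representative \<open>\<Sum> h\<^sub>0 \<otimes> h\<^sub>1\<close> of the coproduct of \<open>h\<close>. The choice is
  arbitrary: all conditions on \<open>\<delta>\<close> here and below depend on the represented tensor only.\<close>

locale hopf_algebra = vector_space scale
  for scale :: "'k::field \<Rightarrow> 'h::ring_1 \<Rightarrow> 'h" +
  fixes \<delta> :: "'h \<Rightarrow> ('h \<times> 'h) list"
    and counit :: "'h \<Rightarrow> 'k"
    and antipode :: "'h \<Rightarrow> 'h"
  assumes scale_mult_left: "scale c x * y = scale c (x * y)"
    and scale_mult_right: "x * scale c y = scale c (x * y)"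
    and coprod_plus: "tensor2_eq scale (\<delta> (g + h)) (\<delta> g @ \<delta> h)"
    and coprod_scale: "tensor2_eq scale (\<delta> (scale c h)) [(scale c a, b). (a, b) \<leftarrow> \<delta> h]"
    and coprod_one: "tensor2_eq scale (\<delta> 1) [(1, 1)]"
    and coprod_mult:
      "tensor2_eq scale (\<delta> (g * h)) [(a * a', b * b'). (a, b) \<leftarrow> \<delta> g, (a', b') \<leftarrow> \<delta> h]"
    and coassoc:
      "tensor_eq scale [[a0, a1, b]. (a, b) \<leftarrow> \<delta> h, (a0, a1) \<leftarrow> \<delta> a]
                       [[a, b0, b1]. (a, b) \<leftarrow> \<delta> h, (b0, b1) \<leftarrow> \<delta> b]"
    and counit_linear: "Vector_Spaces.linear scale (*) counit"
    and counit_one: "counit 1 = 1"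
    and counit_mult: "counit (g * h) = counit g * counit h"
    and counit_left: "(\<Sum>(a, b)\<leftarrow>\<delta> h. scale (counit a) b) = h"
    and counit_right: "(\<Sum>(a, b)\<leftarrow>\<delta> h. scale (counit b) a) = h"
    and antipode_linear: "Vector_Spaces.linear scale scale antipode"
    and antipode_left: "(\<Sum>(a, b)\<leftarrow>\<delta> h. antipode a * b) = scale (counit h) 1"
    and antipode_right: "(\<Sum>(a, b)\<leftarrow>\<delta> h. a * antipode b) = scale (counit h) 1"

definition dual_algebra ::
    "('k::field \<Rightarrow> 'h::ring_1 \<Rightarrow> 'h) \<Rightarrow> ('h \<Rightarrow> ('h \<times> 'h) list) \<Rightarrow> ('h \<Rightarrow> 'k) \<Rightarrow> ('k, 'h \<Rightarrow> 'k) module"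
  where "dual_algebra scale \<delta> counit =
    \<lparr>carrier = {l. Vector_Spaces.linear scale (*) l},
     mult = \<lambda>l m h. \<Sum>(a, b)\<leftarrow>\<delta> h. l a * m b,
     one = counit,
     zero = \<lambda>h. 0,
     add = \<lambda>l m h. l h + m h,
     smult = \<lambda>c l h. c * l h\<rparr>"

text \<open>Without any finiteness the dual \<open>H\<^sup>*\<close> can be too large to be a quotient of \<open>Q(A)\<close>. It is enough that
  one of \<open>C(A, A)\<close> and \<open>H\<close> is finite-dimensional; the former, which makes \<open>H\<close> finite-dimensional
  by faithfulness of the action, is automatic in tensor categories with finite-dimensional
  hom-spaces.\<close>

definition finite_dim_space :: "('k::field \<Rightarrow> 'h::ab_group_add \<Rightarrow> 'h) \<Rightarrow> bool"
  where "finite_dim_space scale \<longleftrightarrow> (\<exists>B. finite_dimensional_vector_space scale B)"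

definition hopf_action ::
    "('o, 'm, 'k::field, 'z) spherical_data_scheme \<Rightarrow> 'o \<Rightarrow> 'm \<Rightarrow> 'm \<Rightarrow>
     ('k \<Rightarrow> 'h::ring_1 \<Rightarrow> 'h) \<Rightarrow> ('h \<Rightarrow> ('h \<times> 'h) list) \<Rightarrow> ('h \<Rightarrow> 'k) \<Rightarrow> ('h \<Rightarrow> 'm) \<Rightarrow> bool"
  where "hopf_action C A m \<iota> scale \<delta> counit \<rho> \<longleftrightarrow>
    range \<rho> \<subseteq> hom_set C A A \<and>
    (\<forall>g h. \<rho> (g + h) = \<rho> g \<boxplus>\<^bsub>C\<^esub> \<rho> h) \<and>
    (\<forall>c h. \<rho> (scale c h) = c \<bullet>\<^bsub>C\<^esub> \<rho> h) \<and>
    \<rho> 1 = ident C A \<and>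
    (\<forall>g h. \<rho> (g * h) = \<rho> g \<cdot>\<^bsub>C\<^esub> \<rho> h) \<and>
    (\<forall>h. \<rho> h \<cdot>\<^bsub>C\<^esub> m =
      foldr (\<boxplus>\<^bsub>C\<^esub>) [m \<cdot>\<^bsub>C\<^esub> (\<rho> a \<star>\<^bsub>C\<^esub> \<rho> b). (a, b) \<leftarrow> \<delta> h] (zero_mor C (A \<boxtimes>\<^bsub>C\<^esub> A) A)) \<and>
    (\<forall>h. \<rho> h \<cdot>\<^bsub>C\<^esub> \<iota> = counit h \<bullet>\<^bsub>C\<^esub> \<iota>)"

section \<open>Algebra epimorphisms\<close>

text \<open>An algebra is a quotient of another one iff there is an epimorphism in this sense.\<close>

definition algebra_epi :: "('k, 'a) module \<Rightarrow> ('k, 'b) module \<Rightarrow> ('a \<Rightarrow> 'b) \<Rightarrow> bool"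
  where "algebra_epi Q R \<gamma> \<longleftrightarrow>
    \<gamma> \<in> ring_hom Q R \<and>
    (\<forall>c. \<forall>x\<in>carrier Q. \<gamma> (c \<odot>\<^bsub>Q\<^esub> x) = c \<odot>\<^bsub>R\<^esub> \<gamma> x) \<and>
    \<gamma> ` carrier Q = carrier R"

end

theory Submission
  imports Defs
begin

text \<open>For an endomorphism \<open>f\<close> of \<open>A\<close>, connectedness gives \<open>m (f \<otimes> 1) \<kappa> = T f \<bullet> \<iota>\<close> for a scalar \<open>T f\<close>, and
  \<open>\<gamma> x h = T (\<rho> h \<circ> x)\<close> is the required map. The invariance \<open>a \<kappa>\<^sub>1 \<otimes> \<kappa>\<^sub>2 = \<kappa>\<^sub>1 \<otimes> \<kappa>\<^sub>2 a\<close> makes \<open>T\<close> a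
  character of the convolution algebra, whence \<open>\<gamma>\<close> is a homomorphism because \<open>\<rho> h\<close> splits over \<open>m\<close> by the
  coproduct. The trace form on \<open>C(A, A)\<close> may be degenerate, so surjectivity does not come from it;
  rather, \<open>l h = T (\<rho> h)\<close> is an integral on \<open>H\<close> with \<open>l 1 \<noteq> 0\<close>, and the form \<open>l (h g)\<close> of an integral on a
  finite-dimensional Hopf algebra is non-degenerate, so already \<open>\<gamma> \<circ> \<rho>\<close> is onto \<open>H\<^sup>*\<close>.

  The invariance of \<open>\<kappa>\<close> rests on both zigzag identities between \<open>b\<close> and \<open>\<kappa>\<close>. Separability provides one
  of them, and the other follows from the cyclicity of the trace, which is where the naturality and
  monoidality of the spherical structure enter.\<close>

section \<open>Tensor categories\<close>

text \<open>Composing \<open>loop f = T f \<bullet> \<iota>\<close> with \<open>\<epsilon>\<close>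
  shows that the trace of \<open>f\<close> is \<open>T f\<close> times the dimension
  \<open>\<epsilon> \<cdot> \<iota>\<close> of \<open>A\<close>. So \<open>T\<close> is a normalised
  trace; reading it off as the coefficient of \<open>\<iota>\<close> avoids a division by that
  dimension. The integral comes from applying \<open>\<rho> h\<close> to
  \<open>x \<kappa>\<^sub>1\<close> and multiplying by \<open>\<kappa>\<^sub>2\<close>: invariance
  gives \<open>T (\<rho> h)\<close> times \<open>x\<close>, while the coproduct gives the sum of
  \<open>T (\<rho> h\<^sub>1)\<close> times \<open>\<rho> h\<^sub>0 x\<close>. Faithfulness turns
  this equality of endomorphisms into one in \<open>H\<close>. The category is not strict, so
  diagrams cannot be manipulated directly. Morphisms are replaced by operators on right-nested words
  with an arbitrary tail, and the tail is specialised to the unit object only at the end.\<close>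

context k_linear_category
begin

abbreviation src where "src \<equiv> source C"
abbreviation tgt where "tgt \<equiv> target C"
abbreviation idm where "idm \<equiv> ident C"

text \<open>Every morphism has a unique source and target, so typing is kept as equations between
  objects, which the simplifier discharges as side conditions.\<close>

lemma hom_iff: "f \<in> hom_set C X Y \<longleftrightarrow> src f = X \<and> tgt f = Y"
  by (simp add: hom_set_def)

lemma src_ident [simp]: "src (idm X) = X" and tgt_ident [simp]: "tgt (idm X) = X"
  using ident_hom[of X] by (auto simp: hom_iff)

lemma src_comp [simp]: "tgt f = src g \<Longrightarrow> src (g \<cdot> f) = src f"
  and tgt_comp [simp]: "tgt f = src g \<Longrightarrow> tgt (g \<cdot> f) = tgt g"
  using compose_hom[of f "src f" "tgt f" g "tgt g"] by (auto simp: hom_iff)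

lemma comp_assoc [simp]: "\<lbrakk>tgt f = src g; tgt g = src h\<rbrakk> \<Longrightarrow> h \<cdot> g \<cdot> f = h \<cdot> (g \<cdot> f)"
  using compose_assoc[of f "src f" "tgt f" g "tgt g" h "tgt h"] by (auto simp: hom_iff)

lemma ident_comp [simp]: "tgt f = X \<Longrightarrow> idm X \<cdot> f = f"
  and comp_ident [simp]: "src f = X \<Longrightarrow> f \<cdot> idm X = f"
  using compose_ident_left[of f "src f" "tgt f"] compose_ident_right[of f "src f" "tgt f"]
  by (auto simp: hom_iff)

text \<open>\<open>comp_assoc\<close> nests composites to the right, where the redex
  \<open>g \<cdot> f\<close> of an equation is hidden inside \<open>g \<cdot> (f \<cdot> x)\<close>.
  This rule and its two variants make equations applicable there.\<close>

lemma comp_rewrite: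
  "\<lbrakk>g \<cdot> f = k; tgt f = src g; tgt x = src f\<rbrakk> \<Longrightarrow> g \<cdot> (f \<cdot> x) = k \<cdot> x"
  by (metis comp_assoc)

lemma comp_rewrite2:
  "\<lbrakk>g \<cdot> f = k \<cdot> l; tgt f = src g; tgt l = src k; src f = src l; tgt x = src f\<rbrakk> \<Longrightarrow>
    g \<cdot> (f \<cdot> x) = k \<cdot> (l \<cdot> x)"
  by (metis comp_assoc)

lemma comp_rewrite3:
  "\<lbrakk>h \<cdot> (g \<cdot> f) = k; tgt f = src g; tgt g = src h; tgt x = src f\<rbrakk> \<Longrightarrow>
    h \<cdot> (g \<cdot> (f \<cdot> x)) = k \<cdot> x"
  by (metis comp_assoc src_comp tgt_comp)

lemma inv_mor_unique: "\<lbrakk>inverse_mors C f g; inverse_mors C f h\<rbrakk> \<Longrightarrow> g = h"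
  unfolding inverse_mors_def hom_iff by (metis comp_assoc comp_ident ident_comp)

lemma inverse_mors_inv: "iso_mor C f \<Longrightarrow> inverse_mors C f (inv_mor C f)"
  unfolding iso_mor_def inv_mor_def by (metis inv_mor_unique theI)

lemma inv_mor_simps:
  assumes "iso_mor C f"
  shows "src (inv_mor C f) = tgt f" "tgt (inv_mor C f) = src f"
    "inv_mor C f \<cdot> f = idm (src f)" "f \<cdot> inv_mor C f = idm (tgt f)"
    "tgt x = src f \<Longrightarrow> inv_mor C f \<cdot> (f \<cdot> x) = x"
    "tgt x = tgt f \<Longrightarrow> f \<cdot> (inv_mor C f \<cdot> x) = x"
proof -
  note inv = inverse_mors_inv[OF assms, unfolded inverse_mors_def hom_iff]
  then show "src (inv_mor C f) = tgt f" "tgt (inv_mor C f) = src f"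
    "inv_mor C f \<cdot> f = idm (src f)" "f \<cdot> inv_mor C f = idm (tgt f)"
    by auto
  show "tgt x = src f \<Longrightarrow> inv_mor C f \<cdot> (f \<cdot> x) = x"
    using inv by (metis comp_assoc ident_comp)
  show "tgt x = tgt f \<Longrightarrow> f \<cdot> (inv_mor C f \<cdot> x) = x"
    using inv by (metis comp_assoc ident_comp)
qed

lemma iso_cancel_left:
  "\<lbrakk>iso_mor C f; f \<cdot> x = f \<cdot> y; tgt x = src f; tgt y = src f\<rbrakk> \<Longrightarrow> x = y"
  by (metis inv_mor_simps(5))

lemma iso_cancel_right:
  assumes "iso_mor C f" "x \<cdot> f = y \<cdot> f" "src x = tgt f" "src y = tgt f"
  shows "x = y"
proof -
  have "x \<cdot> f \<cdot> inv_mor C f = y \<cdot> f \<cdot> inv_mor C f" using assms(2) by simp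
  then show ?thesis using assms(3,4) inv_mor_simps[OF assms(1)] by simp
qed

end

text \<open>One-sided tensoring gets its own constants so that functoriality in one variable can be
  a simp rule, while exchanging two independent factors remains an explicit step
  (\<open>interchange\<close>).\<close>

definition (in tensor_category) whisker :: "'o \<Rightarrow> 'm \<Rightarrow> 'm"  (infixr \<open>\<rhd>\<close> 74)
  where "X \<rhd> f = ident C X \<star> f"

definition (in tensor_category) tensored :: "'m \<Rightarrow> 'o \<Rightarrow> 'm"  (infix \<open>\<lhd>\<close> 74)
  where "f \<lhd> W = f \<star> ident C W"

context tensor_category
begin

abbreviation unitob (\<open>\<I>\<close>) where "\<I> \<equiv> unit_ob C"
abbreviation ass (\<open>\<alpha>\<close>) where "\<alpha> \<equiv> associator C"
abbreviation ass_inv (\<open>\<alpha>''\<close>) where "\<alpha>' X Y Z \<equiv> inv_mor C (\<alpha> X Y Z)"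
abbreviation lu (\<open>\<l>\<close>) where "\<l> \<equiv> lunitor C"
abbreviation lu_inv (\<open>\<l>''\<close>) where "\<l>' X \<equiv> inv_mor C (\<l> X)"
abbreviation ru (\<open>\<r>\<close>) where "\<r> \<equiv> runitor C"
abbreviation ru_inv (\<open>\<r>''\<close>) where "\<r>' X \<equiv> inv_mor C (\<r> X)"

lemma tensor_simps [simp]:
  "src (f \<star> g) = src f \<boxtimes> src g" "tgt (f \<star> g) = tgt f \<boxtimes> tgt g"
  "src (\<alpha> X Y Z) = (X \<boxtimes> Y) \<boxtimes> Z" "tgt (\<alpha> X Y Z) = X \<boxtimes> (Y \<boxtimes> Z)"
  "src (\<l> X) = \<I> \<boxtimes> X" "tgt (\<l> X) = X" "src (\<r> X) = X \<boxtimes> \<I>" "tgt (\<r> X) = X"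
  using tensor_hom[of f "src f" "tgt f" g "src g" "tgt g"]
    associator_hom[of X Y Z] lunitor_hom[of X] runitor_hom[of X]
  by (auto simp: hom_iff)

lemma iso_structure [simp]: "iso_mor C (\<alpha> X Y Z)" "iso_mor C (\<l> X)" "iso_mor C (\<r> X)"
  by (fact associator_iso lunitor_iso runitor_iso)+

lemmas structure_inv [simp] =
  inv_mor_simps[OF associator_iso, simplified]
  inv_mor_simps[OF lunitor_iso, simplified]
  inv_mor_simps[OF runitor_iso, simplified]

lemma whisker_simps [simp]:
  "src (X \<rhd> f) = X \<boxtimes> src f" "tgt (X \<rhd> f) = X \<boxtimes> tgt f"
  "src (f \<lhd> X) = src f \<boxtimes> X" "tgt (f \<lhd> X) = tgt f \<boxtimes> X"
  "X \<rhd> idm Y = idm (X \<boxtimes> Y)" "idm X \<lhd> Y = idm (X \<boxtimes> Y)"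
  by (simp_all add: whisker_def tensored_def tensor_ident)

lemma tensor_comp: "\<lbrakk>tgt f = src f'; tgt g = src g'\<rbrakk> \<Longrightarrow> (f' \<cdot> f) \<star> (g' \<cdot> g) = (f' \<star> g') \<cdot> (f \<star> g)"
  using tensor_compose[of f "src f" "tgt f" f' "tgt f'" g "src g" "tgt g" g' "tgt g'"]
  by (auto simp: hom_iff)

lemma whisker_comp [simp]: "tgt f = src g \<Longrightarrow> X \<rhd> (g \<cdot> f) = (X \<rhd> g) \<cdot> (X \<rhd> f)"
  using tensor_comp[of "idm X" "idm X" f g] by (simp add: whisker_def)

lemma tensored_comp [simp]: "tgt f = src g \<Longrightarrow> (g \<cdot> f) \<lhd> X = (g \<lhd> X) \<cdot> (f \<lhd> X)"
  using tensor_comp[of f g "idm X" "idm X"] by (simp add: tensored_def)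

lemma tensor_whiskers: "f \<star> g = (tgt f \<rhd> g) \<cdot> (f \<lhd> src g)"
  using tensor_comp[of f "idm (tgt f)" "idm (src g)" g] by (simp add: whisker_def tensored_def)

lemma interchange:
  "(f \<lhd> tgt g) \<cdot> (src f \<rhd> g) = (tgt f \<rhd> g) \<cdot> (f \<lhd> src g)"
  using tensor_comp[of f "idm (tgt f)" "idm (src g)" g] tensor_comp[of "idm (src f)" f g "idm (tgt g)"]
  by (simp add: whisker_def tensored_def)

lemma interchange':
  "\<lbrakk>src f = X; tgt f = Y; src g = V; tgt g = W\<rbrakk> \<Longrightarrow> (f \<lhd> W) \<cdot> (X \<rhd> g) = (Y \<rhd> g) \<cdot> (f \<lhd> V)"
  using interchange by blast

lemma inv_naturality:
  assumes "iso_mor C s" "iso_mor C t" "t \<cdot> f = g \<cdot> s" "tgt f = src t" "src g = tgt s"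
    "src f = src s" "tgt g = tgt t"
  shows "inv_mor C t \<cdot> g = f \<cdot> inv_mor C s"
proof -
  have "inv_mor C t \<cdot> (t \<cdot> f) \<cdot> inv_mor C s = inv_mor C t \<cdot> (g \<cdot> s) \<cdot> inv_mor C s"
    using assms(3) by simp
  then show ?thesis
    using assms(4-7) inv_mor_simps[OF assms(1)] inv_mor_simps[OF assms(2)] by simp
qed

lemma assoc_nat:
  "\<lbrakk>src f = X; src g = Y; src h = Z\<rbrakk> \<Longrightarrow>
    \<alpha> (tgt f) (tgt g) (tgt h) \<cdot> ((f \<star> g) \<star> h) = (f \<star> (g \<star> h)) \<cdot> \<alpha> X Y Z"
  using associator_natural[of f X "tgt f" g Y "tgt g" h Z "tgt h"] by (auto simp: hom_iff)

lemma assoc_nat1: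
  "\<lbrakk>src f = X; tgt f = X'\<rbrakk> \<Longrightarrow> \<alpha> X' Y Z \<cdot> ((f \<lhd> Y) \<lhd> Z) = (f \<lhd> Y \<boxtimes> Z) \<cdot> \<alpha> X Y Z"
  using assoc_nat[of f X "idm Y" Y "idm Z" Z] by (simp add: whisker_def tensored_def tensor_ident)

lemma assoc_nat2:
  "\<lbrakk>src f = Y; tgt f = Y'\<rbrakk> \<Longrightarrow> \<alpha> X Y' Z \<cdot> ((X \<rhd> f) \<lhd> Z) = (X \<rhd> (f \<lhd> Z)) \<cdot> \<alpha> X Y Z"
  using assoc_nat[of "idm X" X f Y "idm Z" Z] by (simp add: whisker_def tensored_def tensor_ident)

lemma assoc_nat3:
  "\<lbrakk>src f = Z; tgt f = Z'\<rbrakk> \<Longrightarrow> \<alpha> X Y Z' \<cdot> (X \<boxtimes> Y \<rhd> f) = (X \<rhd> Y \<rhd> f) \<cdot> \<alpha> X Y Z"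
  using assoc_nat[of "idm X" X "idm Y" Y f Z] by (simp add: whisker_def tensored_def tensor_ident)

lemma assoc_inv_nat1:
  "\<lbrakk>src f = X; tgt f = X'\<rbrakk> \<Longrightarrow> \<alpha>' X' Y Z \<cdot> (f \<lhd> Y \<boxtimes> Z) = ((f \<lhd> Y) \<lhd> Z) \<cdot> \<alpha>' X Y Z"
  by (rule inv_naturality) (simp_all add: assoc_nat1)

lemma assoc_inv_nat2:
  "\<lbrakk>src f = Y; tgt f = Y'\<rbrakk> \<Longrightarrow> \<alpha>' X Y' Z \<cdot> (X \<rhd> (f \<lhd> Z)) = ((X \<rhd> f) \<lhd> Z) \<cdot> \<alpha>' X Y Z"
  by (rule inv_naturality) (simp_all add: assoc_nat2)

lemma assoc_inv_nat3:
  "\<lbrakk>src f = Z; tgt f = Z'\<rbrakk> \<Longrightarrow> \<alpha>' X Y Z' \<cdot> (X \<rhd> Y \<rhd> f) = (X \<boxtimes> Y \<rhd> f) \<cdot> \<alpha>' X Y Z"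
  by (rule inv_naturality) (simp_all add: assoc_nat3)

lemma lunit_nat: "\<lbrakk>src f = X; tgt f = Y\<rbrakk> \<Longrightarrow> \<l> Y \<cdot> (\<I> \<rhd> f) = f \<cdot> \<l> X"
  using lunitor_natural[of f X Y] by (auto simp: hom_iff whisker_def)

lemma runit_nat: "\<lbrakk>src f = X; tgt f = Y\<rbrakk> \<Longrightarrow> \<r> Y \<cdot> (f \<lhd> \<I>) = f \<cdot> \<r> X"
  using runitor_natural[of f X Y] by (auto simp: hom_iff tensored_def)

lemma lunit_inv_nat: "\<lbrakk>src f = X; tgt f = Y\<rbrakk> \<Longrightarrow> \<l>' Y \<cdot> f = (\<I> \<rhd> f) \<cdot> \<l>' X"
  by (rule inv_naturality) (simp_all add: lunit_nat)

lemma pentagon':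
  "\<alpha> W X (Y \<boxtimes> Z) \<cdot> \<alpha> (W \<boxtimes> X) Y Z = (W \<rhd> \<alpha> X Y Z) \<cdot> (\<alpha> W (X \<boxtimes> Y) Z \<cdot> (\<alpha> W X Y \<lhd> Z))"
  using pentagon[of W X Y Z] by (simp add: whisker_def tensored_def)

lemma triangle': "(X \<rhd> \<l> Y) \<cdot> \<alpha> X \<I> Y = \<r> X \<lhd> Y"
  using triangle[of X Y] by (simp add: whisker_def tensored_def)

lemma whisker_inverse:
  "\<lbrakk>g \<cdot> f = idm Y; src f = Y; tgt f = src g\<rbrakk> \<Longrightarrow> (X \<rhd> g) \<cdot> (X \<rhd> f) = idm (X \<boxtimes> Y)"
  by (metis whisker_comp whisker_simps(5))

lemma whisker_rewrite:
  "\<lbrakk>g \<cdot> f = k \<cdot> l; tgt f = src g; tgt l = src k\<rbrakk> \<Longrightarrow> (X \<rhd> g) \<cdot> (X \<rhd> f) = (X \<rhd> k) \<cdot> (X \<rhd> l)"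
  by (metis whisker_comp)

lemma tensored_inverse:
  "\<lbrakk>g \<cdot> f = idm Y; src f = Y; tgt f = src g\<rbrakk> \<Longrightarrow> (g \<lhd> X) \<cdot> (f \<lhd> X) = idm (Y \<boxtimes> X)"
  by (metis tensored_comp whisker_simps(6))

text \<open>The left unitor is a natural isomorphism, so \<open>\<I> \<rhd> f\<close> is conjugate
  to \<open>f\<close>.\<close>

lemma unit_whisker_inj:
  "\<lbrakk>\<I> \<rhd> f = \<I> \<rhd> g; src f = src g; tgt f = tgt g\<rbrakk> \<Longrightarrow> f = g"
  by (metis lunit_nat iso_cancel_right iso_structure(2) tensor_simps(6))

lemma tensored_unit_inj:
  "\<lbrakk>f \<lhd> \<I> = g \<lhd> \<I>; src f = src g; tgt f = tgt g\<rbrakk> \<Longrightarrow> f = g"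
  by (metis runit_nat iso_cancel_right iso_structure(3) tensor_simps(8))

lemma tensored_iso:
  assumes "iso_mor C f" shows "iso_mor C (f \<lhd> X)"
  using tensored_inverse[of "inv_mor C f" f "src f" X] tensored_inverse[of f "inv_mor C f" "tgt f" X]
    inv_mor_simps[OF assms]
  unfolding iso_mor_def inverse_mors_def hom_iff
  by (intro exI[of _ "inv_mor C f \<lhd> X"]) simp

text \<open>Kelly's derivation of a unit coherence that is not among the axioms: with a further unit
  in front, pentagon and triangle identify both sides, and \<open>unit_whisker_inj\<close> strips
  that unit.\<close>

lemma lunit_tensor: "\<l> (X \<boxtimes> Y) \<cdot> \<alpha> \<I> X Y = \<l> X \<lhd> Y"
proof (rule unit_whisker_inj)
  let ?a = "\<alpha> \<I> (\<I> \<boxtimes> X) Y" and ?b = "\<alpha> \<I> \<I> X \<lhd> Y"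
  have "(\<I> \<rhd> (\<l> (X \<boxtimes> Y) \<cdot> \<alpha> \<I> X Y)) \<cdot> ?a \<cdot> ?b
      = (\<I> \<rhd> \<l> (X \<boxtimes> Y)) \<cdot> ((\<I> \<rhd> \<alpha> \<I> X Y) \<cdot> (?a \<cdot> ?b))"
    by simp
  also have "\<dots> = (\<I> \<rhd> \<l> (X \<boxtimes> Y)) \<cdot> (\<alpha> \<I> \<I> (X \<boxtimes> Y) \<cdot> \<alpha> (\<I> \<boxtimes> \<I>) X Y)"
    by (simp only: pentagon')
  also have "\<dots> = (\<r> \<I> \<lhd> X \<boxtimes> Y) \<cdot> \<alpha> (\<I> \<boxtimes> \<I>) X Y"
    by (simp add: comp_rewrite[OF triangle'])
  also have "\<dots> = \<alpha> \<I> X Y \<cdot> ((\<r> \<I> \<lhd> X) \<lhd> Y)"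
    by (simp add: assoc_nat1)
  also have "\<dots> = \<alpha> \<I> X Y \<cdot> (((\<I> \<rhd> \<l> X) \<lhd> Y) \<cdot> ?b)"
    by (simp flip: triangle')
  also have "\<dots> = (\<I> \<rhd> (\<l> X \<lhd> Y)) \<cdot> ?a \<cdot> ?b"
    by (simp add: comp_rewrite2[OF assoc_nat2])
  finally have eq: "(\<I> \<rhd> (\<l> (X \<boxtimes> Y) \<cdot> \<alpha> \<I> X Y)) \<cdot> ?a \<cdot> ?b = (\<I> \<rhd> (\<l> X \<lhd> Y)) \<cdot> ?a \<cdot> ?b" .
  have "(\<I> \<rhd> (\<l> (X \<boxtimes> Y) \<cdot> \<alpha> \<I> X Y)) \<cdot> ?a = (\<I> \<rhd> (\<l> X \<lhd> Y)) \<cdot> ?a"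
    using eq by (rule iso_cancel_right[rotated]) (simp_all add: tensored_iso)
  then show "\<I> \<rhd> (\<l> (X \<boxtimes> Y) \<cdot> \<alpha> \<I> X Y) = \<I> \<rhd> (\<l> X \<lhd> Y)"
    by (rule iso_cancel_right[rotated]) simp_all
qed simp_all

lemma lunit_inv_tensor: "\<alpha> \<I> X Y \<cdot> (\<l>' X \<lhd> Y) = \<l>' (X \<boxtimes> Y)"
proof (rule iso_cancel_left)
  show "\<l> (X \<boxtimes> Y) \<cdot> (\<alpha> \<I> X Y \<cdot> (\<l>' X \<lhd> Y)) = \<l> (X \<boxtimes> Y) \<cdot> \<l>' (X \<boxtimes> Y)"
    by (simp add: comp_rewrite[OF lunit_tensor] tensored_inverse)
qed simp_all

lemma triangle_inv: "\<alpha> X \<I> Y \<cdot> (\<r>' X \<lhd> Y) = (X \<rhd> \<l>' Y)"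
proof -
  have "(X \<rhd> \<l>' Y) \<cdot> ((X \<rhd> \<l> Y) \<cdot> (\<alpha> X \<I> Y \<cdot> (\<r>' X \<lhd> Y))) = (X \<rhd> \<l>' Y)"
    by (simp add: comp_rewrite[OF triangle'] tensored_inverse)
  then show ?thesis
    by (simp add: comp_rewrite[OF whisker_inverse[of "\<l>' Y" "\<l> Y" "\<I> \<boxtimes> Y"]])
qed

text \<open>A morphism \<open>X \<otimes> Y \<rightarrow> Z\<close> acts on the head of every right-nested word \<open>X \<otimes> (Y \<otimes> W)\<close>, naturally in
  the tail \<open>W\<close>. In terms of these families, composed with whiskerings on the left, string diagrams
  can be manipulated as in a strict category: the associators are absorbed once and for all.\<close>

definition app2 where "app2 p X Y W = (p \<lhd> W) \<cdot> \<alpha>' X Y W"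
definition cap where "cap p X Y W = \<l> W \<cdot> app2 p X Y W"
definition cup where "cup q X Y W = \<alpha> X Y W \<cdot> ((q \<lhd> W) \<cdot> \<l>' W)"

lemma app2_simps [simp]:
  assumes "src p = X \<boxtimes> Y"
  shows "src (app2 p X Y W) = X \<boxtimes> (Y \<boxtimes> W)" "tgt (app2 p X Y W) = tgt p \<boxtimes> W"
  using assms by (simp_all add: app2_def)

lemma cap_simps [simp]:
  assumes "src p = X \<boxtimes> Y" "tgt p = \<I>"
  shows "src (cap p X Y W) = X \<boxtimes> (Y \<boxtimes> W)" "tgt (cap p X Y W) = W"
  using assms by (simp_all add: cap_def)

lemma cup_simps [simp]:
  assumes "tgt q = X \<boxtimes> Y" "src q = \<I>"
  shows "src (cup q X Y W) = W" "tgt (cup q X Y W) = X \<boxtimes> (Y \<boxtimes> W)"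
  using assms by (simp_all add: cup_def)

lemma app2_nat:
  assumes "src p = X \<boxtimes> Y" "src f = V" "tgt f = W"
  shows "app2 p X Y W \<cdot> (X \<rhd> Y \<rhd> f) = (tgt p \<rhd> f) \<cdot> app2 p X Y V"
  using assms
  by (simp add: app2_def assoc_inv_nat3
        comp_rewrite2[OF interchange'[OF assms(1) HOL.refl assms(2,3)]])

lemma cap_nat:
  assumes "src p = X \<boxtimes> Y" "tgt p = \<I>" "src f = V" "tgt f = W"
  shows "cap p X Y W \<cdot> (X \<rhd> Y \<rhd> f) = f \<cdot> cap p X Y V"
  using assms by (simp add: cap_def app2_nat comp_rewrite2[OF lunit_nat[OF assms(3,4)]])

lemma cup_nat:
  assumes "tgt q = X \<boxtimes> Y" "src q = \<I>" "src f = V" "tgt f = W"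
  shows "cup q X Y W \<cdot> f = (X \<rhd> Y \<rhd> f) \<cdot> cup q X Y V"
  using assms
  by (simp add: cup_def lunit_inv_nat comp_rewrite2[OF assoc_nat3[symmetric]]
      comp_rewrite2[OF interchange'[OF assms(2,1) assms(3,4)]])

text \<open>The left-hand side contains the shape in which \<open>canonical_trace\<close> and
  \<open>dual_mult\<close> are defined, so this translates those definitions into operators;
  pentagon and triangle absorb the associators.\<close>

lemma app2_cup:
  assumes "src r = X \<boxtimes> Y" "src q = \<I>" "tgt q = Y \<boxtimes> Z"
  shows "\<alpha> (tgt r) Z W \<cdot> (((r \<lhd> Z) \<cdot> (\<alpha>' X Y Z \<cdot> ((X \<rhd> q) \<cdot> \<r>' X))) \<lhd> W) =
    app2 r X Y (Z \<boxtimes> W) \<cdot> (X \<rhd> cup q Y Z W)"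
proof -
  have pent: "\<alpha> (X \<boxtimes> Y) Z W \<cdot> (\<alpha>' X Y Z \<lhd> W) = \<alpha>' X Y (Z \<boxtimes> W) \<cdot> ((X \<rhd> \<alpha> Y Z W) \<cdot> \<alpha> X (Y \<boxtimes> Z) W)"
  proof (rule iso_cancel_left)
    have "\<alpha> X Y (Z \<boxtimes> W) \<cdot> (\<alpha> (X \<boxtimes> Y) Z W \<cdot> (\<alpha>' X Y Z \<lhd> W)) =
       (X \<rhd> \<alpha> Y Z W) \<cdot> (\<alpha> X (Y \<boxtimes> Z) W \<cdot> ((\<alpha> X Y Z \<lhd> W) \<cdot> (\<alpha>' X Y Z \<lhd> W)))"
      by (simp add: comp_rewrite[OF pentagon'])
    then show "\<alpha> X Y (Z \<boxtimes> W) \<cdot> (\<alpha> (X \<boxtimes> Y) Z W \<cdot> (\<alpha>' X Y Z \<lhd> W)) =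
       \<alpha> X Y (Z \<boxtimes> W) \<cdot> (\<alpha>' X Y (Z \<boxtimes> W) \<cdot> ((X \<rhd> \<alpha> Y Z W) \<cdot> \<alpha> X (Y \<boxtimes> Z) W))"
      by (simp add: tensored_inverse)
  qed simp_all
  have "\<alpha> (tgt r) Z W \<cdot> (((r \<lhd> Z) \<cdot> (\<alpha>' X Y Z \<cdot> ((X \<rhd> q) \<cdot> \<r>' X))) \<lhd> W) =
    (r \<lhd> Z \<boxtimes> W) \<cdot> (\<alpha> (X \<boxtimes> Y) Z W \<cdot> ((\<alpha>' X Y Z \<lhd> W) \<cdot> (((X \<rhd> q) \<lhd> W) \<cdot> (\<r>' X \<lhd> W))))"
    using assms by (simp add: comp_rewrite2[OF assoc_nat1])
  also have "\<dots> = (r \<lhd> Z \<boxtimes> W) \<cdot> (\<alpha>' X Y (Z \<boxtimes> W) \<cdot> ((X \<rhd> \<alpha> Y Z W) \<cdot>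
      (\<alpha> X (Y \<boxtimes> Z) W \<cdot> (((X \<rhd> q) \<lhd> W) \<cdot> (\<r>' X \<lhd> W)))))"
    using assms by (simp add: comp_rewrite[OF pent])
  also have "\<dots> = (r \<lhd> Z \<boxtimes> W) \<cdot> (\<alpha>' X Y (Z \<boxtimes> W) \<cdot> ((X \<rhd> \<alpha> Y Z W) \<cdot>
      ((X \<rhd> (q \<lhd> W)) \<cdot> (X \<rhd> \<l>' W))))"
    using assms by (simp add: comp_rewrite2[OF assoc_nat2[OF assms(2,3)]] triangle_inv)
  also have "\<dots> = app2 r X Y (Z \<boxtimes> W) \<cdot> (X \<rhd> cup q Y Z W)"
    using assms by (simp add: app2_def cup_def)
  finally show ?thesis .
qed

text \<open>With target \<open>\<I>\<close> the composite of \<open>app2_cup\<close> becomes a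
  zigzag, and \<open>lunit_tensor\<close> absorbs the last unitor. In this form
  \<open>transpose_mor\<close> and the defining equation of \<open>kappa\<close> enter.\<close>

lemma cap_cup:
  assumes "src r = X \<boxtimes> Y" "tgt r = \<I>" "src q = \<I>" "tgt q = Y \<boxtimes> Z"
  shows "cap r X Y (Z \<boxtimes> W) \<cdot> (X \<rhd> cup q Y Z W) =
    (\<l> Z \<cdot> ((r \<lhd> Z) \<cdot> (\<alpha>' X Y Z \<cdot> ((X \<rhd> q) \<cdot> \<r>' X)))) \<lhd> W"
proof -
  have "cap r X Y (Z \<boxtimes> W) \<cdot> (X \<rhd> cup q Y Z W) =
      \<l> (Z \<boxtimes> W) \<cdot> (app2 r X Y (Z \<boxtimes> W) \<cdot> (X \<rhd> cup q Y Z W))"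
    using assms by (simp add: cap_def)
  also have "\<dots> = \<l> (Z \<boxtimes> W) \<cdot> (\<alpha> \<I> Z W \<cdot> (((r \<lhd> Z) \<cdot> (\<alpha>' X Y Z \<cdot> ((X \<rhd> q) \<cdot> \<r>' X))) \<lhd> W))"
    using app2_cup[OF assms(1,3,4), of W] assms by simp
  also have "\<dots> = (\<l> Z \<cdot> ((r \<lhd> Z) \<cdot> (\<alpha>' X Y Z \<cdot> ((X \<rhd> q) \<cdot> \<r>' X)))) \<lhd> W"
    using assms by (simp add: comp_rewrite[OF lunit_tensor])
  finally show ?thesis .
qed

text \<open>The mirror image of \<open>cap_cup\<close>, for zigzags with the cup on the left: it
  brings \<open>zigzag_ob\<close> into operator form.\<close>

lemma whisker_cap_cup:
  assumes "src p = Y \<boxtimes> Z" "tgt p = \<I>" "src q = \<I>" "tgt q = X \<boxtimes> Y"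
  shows "(X \<rhd> cap p Y Z W) \<cdot> cup q X Y (Z \<boxtimes> W) =
    (\<r> X \<cdot> ((X \<rhd> p) \<cdot> (\<alpha> X Y Z \<cdot> ((q \<lhd> Z) \<cdot> \<l>' Z)))) \<lhd> W"
proof -
  have pent: "(X \<rhd> \<alpha>' Y Z W) \<cdot> (\<alpha> X Y (Z \<boxtimes> W) \<cdot> \<alpha> (X \<boxtimes> Y) Z W) = \<alpha> X (Y \<boxtimes> Z) W \<cdot> (\<alpha> X Y Z \<lhd> W)"
    by (simp add: pentagon' comp_rewrite[OF whisker_inverse[of "\<alpha>' Y Z W" "\<alpha> Y Z W"]])
  have "(X \<rhd> cap p Y Z W) \<cdot> cup q X Y (Z \<boxtimes> W) =
      (X \<rhd> \<l> W) \<cdot> ((X \<rhd> (p \<lhd> W)) \<cdot> ((X \<rhd> \<alpha>' Y Z W) \<cdot> (\<alpha> X Y (Z \<boxtimes> W) \<cdot>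
        ((q \<lhd> Z \<boxtimes> W) \<cdot> (\<alpha> \<I> Z W \<cdot> (\<l>' Z \<lhd> W))))))"
    using assms by (simp add: cap_def app2_def cup_def lunit_inv_tensor)
  also have "\<dots> = (X \<rhd> \<l> W) \<cdot> ((X \<rhd> (p \<lhd> W)) \<cdot> ((X \<rhd> \<alpha>' Y Z W) \<cdot> (\<alpha> X Y (Z \<boxtimes> W) \<cdot>
        (\<alpha> (X \<boxtimes> Y) Z W \<cdot> (((q \<lhd> Z) \<lhd> W) \<cdot> (\<l>' Z \<lhd> W))))))"
    using assms by (simp add: comp_rewrite2[OF assoc_nat1[OF assms(3,4)]])
  also have "\<dots> = (X \<rhd> \<l> W) \<cdot> ((X \<rhd> (p \<lhd> W)) \<cdot> (\<alpha> X (Y \<boxtimes> Z) W \<cdot> ((\<alpha> X Y Z \<lhd> W) \<cdot>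
        (((q \<lhd> Z) \<lhd> W) \<cdot> (\<l>' Z \<lhd> W)))))"
    using assms by (simp add: comp_rewrite3[OF pent])
  also have "\<dots> = (X \<rhd> \<l> W) \<cdot> (\<alpha> X \<I> W \<cdot> (((X \<rhd> p) \<lhd> W) \<cdot> ((\<alpha> X Y Z \<lhd> W) \<cdot>
        (((q \<lhd> Z) \<lhd> W) \<cdot> (\<l>' Z \<lhd> W)))))"
    using assms by (simp add: comp_rewrite2[OF assoc_nat2[OF assms(1,2), symmetric]])
  also have "\<dots> = (\<r> X \<cdot> ((X \<rhd> p) \<cdot> (\<alpha> X Y Z \<cdot> ((q \<lhd> Z) \<cdot> \<l>' Z)))) \<lhd> W"
    using assms by (simp add: comp_rewrite[OF triangle'])
  finally show ?thesis .
qed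

end

section \<open>Duality\<close>

context spherical_tensor_category
begin

abbreviation dl where "dl \<equiv> dual_ob C"
abbreviation evc where "evc X W \<equiv> cap (ev C X) (dl X) X W"
abbreviation coc where "coc X W \<equiv> cup (coev C X) X (dl X) W"

text \<open>Together with \<open>sph_coev\<close> below, the second duality, in which \<open>X\<^sup>*\<close> is on the right of \<open>X\<close> in the
  evaluation.\<close>

definition sph_ev where "sph_ev X = ev C (dl X) \<cdot> (sph C X \<lhd> dl X)"
abbreviation sevc where "sevc X W \<equiv> cap (sph_ev X) X (dl X) W"

lemma duality_simps [simp]:
  "src (ev C X) = dl X \<boxtimes> X" "tgt (ev C X) = \<I>"
  "src (coev C X) = \<I>" "tgt (coev C X) = X \<boxtimes> dl X"
  "src (sph C X) = X" "tgt (sph C X) = dl (dl X)"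
  "src (sph_ev X) = X \<boxtimes> dl X" "tgt (sph_ev X) = \<I>"
  using ev_hom[of X] ev_hom[of "dl X"] coev_hom[of X] sph_hom[of X]
        by (auto simp: hom_iff sph_ev_def)

lemma evc_coc: "(X \<rhd> evc X W) \<cdot> coc X (X \<boxtimes> W) = idm (X \<boxtimes> W)"
  using zigzag_ob[of X]
        by (simp add: whisker_cap_cup whisker_def[symmetric] tensored_def[symmetric])

lemma sevc_eq: "sevc X W = evc (dl X) W \<cdot> (sph C X \<lhd> dl X \<boxtimes> W)"
  by (simp add: cap_def app2_def sph_ev_def assoc_inv_nat1)

lemma transpose_op:
  assumes "src p = U \<boxtimes> X" "tgt p = \<I>"
  shows "transpose_mor C U X p \<lhd> W = cap p U X (dl X \<boxtimes> W) \<cdot> (U \<rhd> coc X W)"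
  using assms
        by (simp add: cap_cup transpose_mor_def whisker_def[symmetric] tensored_def[symmetric])

lemma transpose_simps [simp]:
  assumes "src p = U \<boxtimes> X" "tgt p = \<I>"
  shows "src (transpose_mor C U X p) = U" "tgt (transpose_mor C U X p) = dl X"
  using assms by (simp_all add: transpose_mor_def)

text \<open>The bent wire is straightened by \<open>evc_coc\<close>. A transpose is thus controlled
  by the pairing it came from, which is how \<open>dual_mor\<close> and \<open>dual_tensor\<close>
  are handled below.\<close>

lemma evc_transpose:
  assumes "src p = U \<boxtimes> X" "tgt p = \<I>"
  shows "evc X W \<cdot> (transpose_mor C U X p \<lhd> X \<boxtimes> W) = cap p U X W"
proof -
  have "evc X W \<cdot> (transpose_mor C U X p \<lhd> X \<boxtimes> W) =
      evc X W \<cdot> (cap p U X (dl X \<boxtimes> (X \<boxtimes> W)) \<cdot> (U \<rhd> coc X (X \<boxtimes> W)))"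
    using assms by (simp add: transpose_op)
  also have "\<dots> = cap p U X W \<cdot> ((U \<rhd> X \<rhd> evc X W) \<cdot> (U \<rhd> coc X (X \<boxtimes> W)))"
    using assms by (simp add: comp_rewrite2[OF cap_nat[OF assms, symmetric]])
  also have "\<dots> = cap p U X W"
    using assms whisker_inverse[OF evc_coc, of X W U] by simp
  finally show ?thesis .
qed

lemma dual_mor_simps [simp]: "src (dual_mor C f) = dl (tgt f)" "tgt (dual_mor C f) = dl (src f)"
  by (simp_all add: dual_mor_def)

lemma cap_precomp:
  assumes "src p = U \<boxtimes> tgt f" "tgt p = \<I>" "src f = X"
  shows "cap (p \<cdot> (U \<rhd> f)) U X W = cap p U (tgt f) W \<cdot> (U \<rhd> (f \<lhd> W))"
  using assms by (simp add: cap_def app2_def assoc_inv_nat2)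

lemma evc_dual:
  assumes "src f = X" "tgt f = Y"
  shows "evc X W \<cdot> (dual_mor C f \<lhd> X \<boxtimes> W) = evc Y W \<cdot> (dl Y \<rhd> (f \<lhd> W))"
  unfolding dual_mor_def using assms
  by (simp add: evc_transpose cap_precomp flip: whisker_def)

text \<open>The coevaluation side of \<open>evc_dual\<close>: unfolding \<open>dual_mor\<close>
  creates a zigzag on \<open>Y\<close>, which \<open>evc_coc\<close> removes.\<close>

lemma dual_coc:
  assumes "src f = X" "tgt f = Y"
  shows "(f \<lhd> dl X \<boxtimes> W) \<cdot> coc X W = (Y \<rhd> (dual_mor C f \<lhd> W)) \<cdot> coc Y W"
proof -
  have "dual_mor C f \<lhd> W = evc Y (dl X \<boxtimes> W) \<cdot> ((dl Y \<rhd> (f \<lhd> dl X \<boxtimes> W)) \<cdot> (dl Y \<rhd> coc X W))"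
    unfolding dual_mor_def using assms
    by (simp add: transpose_op cap_precomp flip: whisker_def)
  then have "(Y \<rhd> (dual_mor C f \<lhd> W)) \<cdot> coc Y W = (Y \<rhd> evc Y (dl X \<boxtimes> W)) \<cdot>
      ((Y \<rhd> dl Y \<rhd> ((f \<lhd> dl X \<boxtimes> W) \<cdot> coc X W)) \<cdot> coc Y W)"
    using assms by simp
  also have "\<dots> = (Y \<rhd> evc Y (dl X \<boxtimes> W)) \<cdot> (coc Y (Y \<boxtimes> (dl X \<boxtimes> W)) \<cdot> ((f \<lhd> dl X \<boxtimes> W) \<cdot> coc X W))"
    using assms cup_nat[of "coev C Y" Y "dl Y" "(f \<lhd> dl X \<boxtimes> W) \<cdot> coc X W" W "Y \<boxtimes> (dl X \<boxtimes> W)"]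
    by simp
  also have "\<dots> = (f \<lhd> dl X \<boxtimes> W) \<cdot> coc X W"
    using assms by (simp add: comp_rewrite[OF evc_coc])
  finally show ?thesis by simp
qed

text \<open>Naturality of \<open>sph\<close> turns \<open>f\<close> into its double dual, and
  \<open>evc_dual\<close> for \<open>dual_mor C f\<close> slides that across the evaluation.\<close>

lemma sevc_dual:
  assumes "src f = X" "tgt f = Y"
  shows "sevc Y W \<cdot> (f \<lhd> dl Y \<boxtimes> W) = sevc X W \<cdot> (X \<rhd> (dual_mor C f \<lhd> W))"
proof -
  have nat: "sph C Y \<cdot> f = dual_mor C (dual_mor C f) \<cdot> sph C X"
    using sph_natural[of f X Y] assms by (simp add: hom_iff)
  have "sevc Y W \<cdot> (f \<lhd> dl Y \<boxtimes> W) = evc (dl Y) W \<cdot> ((sph C Y \<cdot> f) \<lhd> dl Y \<boxtimes> W)"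
    using assms by (simp add: sevc_eq)
  also have "\<dots> = evc (dl Y) W \<cdot> ((dual_mor C (dual_mor C f) \<lhd> dl Y \<boxtimes> W) \<cdot> (sph C X \<lhd> dl Y \<boxtimes> W))"
    using assms by (simp add: nat)
  also have "\<dots> = evc (dl X) W \<cdot> ((dl (dl X) \<rhd> (dual_mor C f \<lhd> W)) \<cdot> (sph C X \<lhd> dl Y \<boxtimes> W))"
    using assms by (simp add: comp_rewrite2[OF evc_dual])
  also have "\<dots> = sevc X W \<cdot> (X \<rhd> (dual_mor C f \<lhd> W))"
    using assms by (simp add: sevc_eq interchange')
  finally show ?thesis .
qed

section \<open>Duals of tensor products\<close>

definition nested_ev where
  "nested_ev X Y = ev C Y \<cdot> ((dl Y \<rhd> cap (ev C X) (dl X) X Y) \<cdot> \<alpha> (dl Y) (dl X) (X \<boxtimes> Y))"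

lemma nested_ev_simps [simp]:
  "src (nested_ev X Y) = (dl Y \<boxtimes> dl X) \<boxtimes> (X \<boxtimes> Y)" "tgt (nested_ev X Y) = \<I>"
  by (simp_all add: nested_ev_def)

lemma dual_tensor_eq:
  "dual_tensor C X Y = transpose_mor C (dl Y \<boxtimes> dl X) (X \<boxtimes> Y) (nested_ev X Y)"
  by (simp add: dual_tensor_def nested_ev_def Let_def cap_def app2_def
      whisker_def[symmetric] tensored_def[symmetric])

lemma assoc_inv_pentagon:
  "\<alpha>' (W \<boxtimes> X) Y Z \<cdot> \<alpha>' W X (Y \<boxtimes> Z) = (\<alpha>' W X Y \<lhd> Z) \<cdot> (\<alpha>' W (X \<boxtimes> Y) Z \<cdot> (W \<rhd> \<alpha>' X Y Z))"
proof (rule iso_cancel_left)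
  let ?p = "\<alpha> W X (Y \<boxtimes> Z)" and ?q = "\<alpha> (W \<boxtimes> X) Y Z"
  have "?p \<cdot> (?q \<cdot> ((\<alpha>' W X Y \<lhd> Z) \<cdot> (\<alpha>' W (X \<boxtimes> Y) Z \<cdot> (W \<rhd> \<alpha>' X Y Z)))) = idm (W \<boxtimes> X \<boxtimes> Y \<boxtimes> Z)"
    by (simp add: comp_rewrite[OF pentagon'] comp_rewrite[OF tensored_inverse[of _ _ "W \<boxtimes> X \<boxtimes> Y"]]
        whisker_inverse)
  then have "?p \<cdot> (?q \<cdot> (\<alpha>' (W \<boxtimes> X) Y Z \<cdot> \<alpha>' W X (Y \<boxtimes> Z))) =
     ?p \<cdot> (?q \<cdot> ((\<alpha>' W X Y \<lhd> Z) \<cdot> (\<alpha>' W (X \<boxtimes> Y) Z \<cdot> (W \<rhd> \<alpha>' X Y Z))))"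
    by simp
  then show "?q \<cdot> (\<alpha>' (W \<boxtimes> X) Y Z \<cdot> \<alpha>' W X (Y \<boxtimes> Z)) =
     ?q \<cdot> ((\<alpha>' W X Y \<lhd> Z) \<cdot> (\<alpha>' W (X \<boxtimes> Y) Z \<cdot> (W \<rhd> \<alpha>' X Y Z)))"
    by (rule iso_cancel_left[rotated]) simp_all
qed simp_all

text \<open>Both sides contract the same two leading factors; only the bracketing of the tail
  differs, which the pentagon and \<open>lunit_tensor\<close> settle.\<close>

lemma cap_tensored:
  assumes "src p = X \<boxtimes> Y" "tgt p = \<I>"
  shows "(cap p X Y Z \<lhd> W) \<cdot> (\<alpha>' X (Y \<boxtimes> Z) W \<cdot> (X \<rhd> \<alpha>' Y Z W)) = cap p X Y (Z \<boxtimes> W)"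
proof -
  have "(cap p X Y Z \<lhd> W) \<cdot> (\<alpha>' X (Y \<boxtimes> Z) W \<cdot> (X \<rhd> \<alpha>' Y Z W)) =
    (\<l> Z \<lhd> W) \<cdot> (((p \<lhd> Z) \<lhd> W) \<cdot> (\<alpha>' (X \<boxtimes> Y) Z W \<cdot> \<alpha>' X Y (Z \<boxtimes> W)))"
    using assms by (simp add: cap_def app2_def assoc_inv_pentagon)
  also have "\<dots> = \<l> (Z \<boxtimes> W) \<cdot> (\<alpha> \<I> Z W \<cdot> (\<alpha>' \<I> Z W \<cdot> ((p \<lhd> Z \<boxtimes> W) \<cdot> \<alpha>' X Y (Z \<boxtimes> W))))"
    using assms by (simp add: comp_rewrite2[OF assoc_inv_nat1] flip: lunit_tensor)
  also have "\<dots> = cap p X Y (Z \<boxtimes> W)"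
    using assms by (simp add: cap_def app2_def)
  finally show ?thesis .
qed

text \<open>Once the words are nested to the right, the pairing behind \<open>dual_tensor\<close> is
  two successive contractions, first of \<open>X\<close>, then of \<open>Y\<close>.\<close>

lemma cap_nested_ev:
  "cap (nested_ev X Y) (dl Y \<boxtimes> dl X) (X \<boxtimes> Y) W \<cdot>
     (\<alpha>' (dl Y) (dl X) ((X \<boxtimes> Y) \<boxtimes> W) \<cdot> (dl Y \<rhd> dl X \<rhd> \<alpha>' X Y W)) =
   evc Y W \<cdot> (dl Y \<rhd> evc X (Y \<boxtimes> W))"
proof -
  let ?c = "cap (ev C X) (dl X) X Y"
  have "cap (nested_ev X Y) (dl Y \<boxtimes> dl X) (X \<boxtimes> Y) W \<cdot>
     (\<alpha>' (dl Y) (dl X) ((X \<boxtimes> Y) \<boxtimes> W) \<cdot> (dl Y \<rhd> dl X \<rhd> \<alpha>' X Y W)) =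
     \<l> W \<cdot> ((ev C Y \<lhd> W) \<cdot> (((dl Y \<rhd> ?c) \<lhd> W) \<cdot> ((\<alpha> (dl Y) (dl X) (X \<boxtimes> Y) \<lhd> W) \<cdot>
      ((\<alpha>' (dl Y) (dl X) (X \<boxtimes> Y) \<lhd> W) \<cdot> (\<alpha>' (dl Y) (dl X \<boxtimes> X \<boxtimes> Y) W \<cdot> ((dl Y \<rhd> \<alpha>' (dl X) (X \<boxtimes> Y) W)
       \<cdot> (dl Y \<rhd> dl X \<rhd> \<alpha>' X Y W)))))))"
    unfolding cap_def[of "nested_ev X Y"] app2_def[of "nested_ev X Y"]
    by (simp add: nested_ev_def comp_rewrite[OF assoc_inv_pentagon])
  also have "\<dots> = \<l> W \<cdot> ((ev C Y \<lhd> W) \<cdot> (((dl Y \<rhd> ?c) \<lhd> W) \<cdot>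
      (\<alpha>' (dl Y) (dl X \<boxtimes> X \<boxtimes> Y) W \<cdot> ((dl Y \<rhd> \<alpha>' (dl X) (X \<boxtimes> Y) W)
       \<cdot> (dl Y \<rhd> dl X \<rhd> \<alpha>' X Y W)))))"
    by (simp add: comp_rewrite[OF tensored_inverse[of _ _ "dl Y \<boxtimes> dl X \<boxtimes> X \<boxtimes> Y"]])
  also have "\<dots> = \<l> W \<cdot> ((ev C Y \<lhd> W) \<cdot> (\<alpha>' (dl Y) Y W \<cdot>
      (dl Y \<rhd> ((?c \<lhd> W) \<cdot> (\<alpha>' (dl X) (X \<boxtimes> Y) W \<cdot> (dl X \<rhd> \<alpha>' X Y W))))))"
    by (simp add: comp_rewrite2[OF assoc_inv_nat2])
  also have "\<dots> = evc Y W \<cdot> (dl Y \<rhd> evc X (Y \<boxtimes> W))"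
    by (simp only: cap_tensored duality_simps) (simp add: cap_def[of "ev C Y"] app2_def[of "ev C Y"])
  finally show ?thesis .
qed

lemma dual_tensor_simps [simp]:
  "src (dual_tensor C X Y) = dl Y \<boxtimes> dl X" "tgt (dual_tensor C X Y) = dl (X \<boxtimes> Y)"
  by (simp_all add: dual_tensor_eq)

definition dual_join where
  "dual_join X Y W = (dual_tensor C X Y \<lhd> W) \<cdot> \<alpha>' (dl Y) (dl X) W"

lemma dual_join_simps [simp]:
  "src (dual_join X Y W) = dl Y \<boxtimes> (dl X \<boxtimes> W)" "tgt (dual_join X Y W) = dl (X \<boxtimes> Y) \<boxtimes> W"
  by (simp_all add: dual_join_def)

text \<open>A coevaluation is determined by its evaluation: expanding \<open>dual_join\<close>
  through \<open>nested_ev\<close> leaves a zigzag on \<open>Y\<close> and one on \<open>X\<close>,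
  both removed by \<open>evc_coc\<close>.\<close>

lemma coc_tensor:
  "coc (X \<boxtimes> Y) W = \<alpha>' X Y (dl (X \<boxtimes> Y) \<boxtimes> W) \<cdot> ((X \<rhd> Y \<rhd> dual_join X Y W) \<cdot>
     ((X \<rhd> coc Y (dl X \<boxtimes> W)) \<cdot> coc X W))"
proof -
  let ?V = "dl (X \<boxtimes> Y) \<boxtimes> W" and ?n = "\<alpha> X Y (dl (X \<boxtimes> Y) \<boxtimes> W) \<cdot> coc (X \<boxtimes> Y) W"
  have "dual_join X Y W = cap (nested_ev X Y) (dl Y \<boxtimes> dl X) (X \<boxtimes> Y) ?V \<cdot>
      (\<alpha>' (dl Y) (dl X) ((X \<boxtimes> Y) \<boxtimes> ?V) \<cdot> (dl Y \<rhd> dl X \<rhd> coc (X \<boxtimes> Y) W))"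
    by (simp add: dual_join_def dual_tensor_eq transpose_op assoc_inv_nat3)
  also have "\<dots> = cap (nested_ev X Y) (dl Y \<boxtimes> dl X) (X \<boxtimes> Y) ?V \<cdot>
      (\<alpha>' (dl Y) (dl X) ((X \<boxtimes> Y) \<boxtimes> ?V) \<cdot> ((dl Y \<rhd> dl X \<rhd> \<alpha>' X Y ?V) \<cdot> (dl Y \<rhd> dl X \<rhd> ?n)))"
    by (simp flip: whisker_comp)
  also have "\<dots> = evc Y ?V \<cdot> ((dl Y \<rhd> evc X (Y \<boxtimes> ?V)) \<cdot> (dl Y \<rhd> dl X \<rhd> ?n))"
    by (simp add: comp_rewrite3[OF cap_nested_ev] del: whisker_comp)
  finally have dj: "dual_join X Y W = \<dots>" .
  have "(X \<rhd> Y \<rhd> dual_join X Y W) \<cdot> ((X \<rhd> coc Y (dl X \<boxtimes> W)) \<cdot> coc X W) =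
     (X \<rhd> Y \<rhd> evc Y ?V) \<cdot> ((X \<rhd> ((Y \<rhd> dl Y \<rhd> (evc X (Y \<boxtimes> ?V) \<cdot> (dl X \<rhd> ?n))) \<cdot>
           coc Y (dl X \<boxtimes> W))) \<cdot> coc X W)"
    by (simp add: dj)
  also have "\<dots> = (X \<rhd> Y \<rhd> evc Y ?V) \<cdot> ((X \<rhd> (coc Y (Y \<boxtimes> ?V) \<cdot> (evc X (Y \<boxtimes> ?V) \<cdot> (dl X \<rhd> ?n)))) \<cdot>
        coc X W)"
    by (simp add: cup_nat[of "coev C Y" Y "dl Y" "evc X (Y \<boxtimes> ?V) \<cdot> (dl X \<rhd> ?n)" "dl X \<boxtimes> W" "Y \<boxtimes> ?V", symmetric]
        del: whisker_comp)
  also have "\<dots> = (X \<rhd> (((Y \<rhd> evc Y ?V) \<cdot> coc Y (Y \<boxtimes> ?V)))) \<cdot> ((X \<rhd> evc X (Y \<boxtimes> ?V)) \<cdot>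
        ((X \<rhd> dl X \<rhd> ?n) \<cdot> coc X W))"
    by simp
  also have "\<dots> = (X \<rhd> evc X (Y \<boxtimes> ?V)) \<cdot> ((X \<rhd> dl X \<rhd> ?n) \<cdot> coc X W)"
    by (simp add: evc_coc del: whisker_comp)
  also have "\<dots> = (X \<rhd> evc X (Y \<boxtimes> ?V)) \<cdot> (coc X (X \<boxtimes> Y \<boxtimes> ?V) \<cdot> ?n)"
    by (simp add: cup_nat[of "coev C X" X "dl X" ?n W "X \<boxtimes> Y \<boxtimes> ?V", symmetric] del: whisker_comp)
  also have "\<dots> = ?n"
    by (simp add: comp_rewrite[OF evc_coc])
  finally show ?thesis by simp
qed

text \<open>Here the monoidality of \<open>sph\<close> is used. Moved across the evaluation,
  \<open>dual_tensor\<close> becomes its dual; \<open>sph_tensor\<close> trades this for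
  \<open>dual_tensor\<close> of the dual objects, whose evaluation splits by
  \<open>cap_nested_ev\<close>.\<close>

lemma sevc_tensor:
  "sevc (X \<boxtimes> Y) W \<cdot> ((X \<boxtimes> Y \<rhd> dual_join X Y W) \<cdot> \<alpha>' X Y (dl Y \<boxtimes> (dl X \<boxtimes> W))) =
   sevc X W \<cdot> (X \<rhd> sevc Y (dl X \<boxtimes> W))"
proof -
  let ?Z = "X \<boxtimes> Y" and ?V = "dl Y \<boxtimes> (dl X \<boxtimes> W)"
  have "sevc ?Z W \<cdot> ((?Z \<rhd> dual_join X Y W) \<cdot> \<alpha>' X Y ?V) =
     evc (dl ?Z) W \<cdot> ((sph C ?Z \<lhd> dl ?Z \<boxtimes> W) \<cdot> ((?Z \<rhd> (dual_tensor C X Y \<lhd> W)) \<cdot>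
      ((?Z \<rhd> \<alpha>' (dl Y) (dl X) W) \<cdot> \<alpha>' X Y ?V)))"
    by (simp add: sevc_eq dual_join_def)
  also have "\<dots> = evc (dl ?Z) W \<cdot> ((dl (dl ?Z) \<rhd> (dual_tensor C X Y \<lhd> W)) \<cdot>
        ((sph C ?Z \<lhd> (dl Y \<boxtimes> dl X) \<boxtimes> W) \<cdot>
      ((?Z \<rhd> \<alpha>' (dl Y) (dl X) W) \<cdot> \<alpha>' X Y ?V)))"
    by (simp add: comp_rewrite2[OF interchange'])
  also have "\<dots> = evc (dl Y \<boxtimes> dl X) W \<cdot> (((dual_mor C (dual_tensor C X Y) \<cdot>
        sph C ?Z) \<lhd> (dl Y \<boxtimes> dl X) \<boxtimes> W) \<cdot>
      ((?Z \<rhd> \<alpha>' (dl Y) (dl X) W) \<cdot> \<alpha>' X Y ?V))"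
    by (simp add: comp_rewrite2[OF evc_dual[symmetric]])
  also have "\<dots> = evc (dl Y \<boxtimes> dl X) W \<cdot> ((dual_tensor C (dl Y) (dl X) \<lhd> (dl Y \<boxtimes> dl X) \<boxtimes> W) \<cdot>
      (((sph C X \<star> sph C Y) \<lhd> (dl Y \<boxtimes> dl X) \<boxtimes> W) \<cdot>
      ((?Z \<rhd> \<alpha>' (dl Y) (dl X) W) \<cdot> \<alpha>' X Y ?V)))"
    unfolding sph_tensor by simp
  also have "\<dots> = cap (nested_ev (dl Y) (dl X)) (dl (dl X) \<boxtimes> dl (dl Y)) (dl Y \<boxtimes> dl X) W \<cdot>
      (((sph C X \<star> sph C Y) \<lhd> (dl Y \<boxtimes> dl X) \<boxtimes> W) \<cdot> ((?Z \<rhd> \<alpha>' (dl Y) (dl X) W) \<cdot> \<alpha>' X Y ?V))"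
    by (simp add: dual_tensor_eq comp_rewrite[OF evc_transpose])
  also have "\<dots> = cap (nested_ev (dl Y) (dl X)) (dl (dl X) \<boxtimes> dl (dl Y)) (dl Y \<boxtimes> dl X) W \<cdot>
      ((dl (dl X) \<boxtimes> dl (dl Y) \<rhd> \<alpha>' (dl Y) (dl X) W) \<cdot> (((sph C X \<star> sph C Y) \<lhd> ?V) \<cdot> \<alpha>' X Y ?V))"
    by (simp add: comp_rewrite2[OF interchange'])
  also have "((sph C X \<star> sph C Y) \<lhd> ?V) \<cdot> \<alpha>' X Y ?V =
      \<alpha>' (dl (dl X)) (dl (dl Y)) ?V \<cdot> ((dl (dl X) \<rhd> (sph C Y \<lhd> ?V)) \<cdot> (sph C X \<lhd> Y \<boxtimes> ?V))"
    by (simp add: tensor_whiskers assoc_inv_nat1 comp_rewrite2[OF assoc_inv_nat2])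
  also have "cap (nested_ev (dl Y) (dl X)) (dl (dl X) \<boxtimes> dl (dl Y)) (dl Y \<boxtimes> dl X) W \<cdot>
      ((dl (dl X) \<boxtimes> dl (dl Y) \<rhd> \<alpha>' (dl Y) (dl X) W) \<cdot>
       (\<alpha>' (dl (dl X)) (dl (dl Y)) ?V \<cdot> ((dl (dl X) \<rhd> (sph C Y \<lhd> ?V)) \<cdot> (sph C X \<lhd> Y \<boxtimes> ?V)))) =
      evc (dl X) W \<cdot> ((dl (dl X) \<rhd> evc (dl Y) (dl X \<boxtimes> W)) \<cdot> ((dl (dl X) \<rhd> (sph C Y \<lhd> ?V)) \<cdot>
        (sph C X \<lhd> Y \<boxtimes> ?V)))"
    by (simp add: comp_rewrite2[OF assoc_inv_nat3[symmetric]] comp_rewrite3[OF cap_nested_ev])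
  also have "\<dots> = sevc X W \<cdot> (X \<rhd> sevc Y (dl X \<boxtimes> W))"
    by (simp add: sevc_eq comp_rewrite2[OF interchange'] interchange')
  finally show ?thesis .
qed

definition sph_coev where "sph_coev X = (dl X \<rhd> inv_mor C (sph C X)) \<cdot> coev C (dl X)"

lemma sph_coev_simps [simp]: "src (sph_coev X) = \<I>" "tgt (sph_coev X) = dl X \<boxtimes> X"
  using inv_mor_simps[OF sph_iso[of X]] by (simp_all add: sph_coev_def)

abbreviation scoc where "scoc X W \<equiv> cup (sph_coev X) (dl X) X W"

text \<open>\<open>sph\<close> cancels against its inverse in \<open>sph_coev\<close>, which leaves
  the zigzag of \<open>dl X\<close>.\<close>

lemma sevc_scoc: "(dl X \<rhd> sevc X W) \<cdot> scoc X (dl X \<boxtimes> W) = idm (dl X \<boxtimes> W)"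
proof -
  note [simp] = inv_mor_simps[OF sph_iso[of X], simplified]
  have "scoc X (dl X \<boxtimes> W) = (dl X \<rhd> (inv_mor C (sph C X) \<lhd> dl X \<boxtimes> W)) \<cdot> coc (dl X) (dl X \<boxtimes> W)"
    by (simp add: sph_coev_def cup_def comp_rewrite2[OF assoc_nat2])
  then show ?thesis
    by (simp add: sevc_eq evc_coc
        comp_rewrite[OF whisker_inverse[OF tensored_inverse, of "sph C X" "inv_mor C (sph C X)" "dl (dl X)"]])
qed

end

section \<open>Linearity\<close>

context k_linear_category
begin

lemma linear_hom [simp]:
  "src (zero_mor C X Y) = X" "tgt (zero_mor C X Y) = Y"
  "src (c \<bullet> f) = src f" "tgt (c \<bullet> f) = tgt f"
  "\<lbrakk>src f = src g; tgt f = tgt g\<rbrakk> \<Longrightarrow> src (f \<boxplus> g) = src g"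
  "\<lbrakk>src f = src g; tgt f = tgt g\<rbrakk> \<Longrightarrow> tgt (f \<boxplus> g) = tgt g"
proof -
  interpret M: Module.module ground_ring "hom_space C U V" for U V
    by (rule hom_vector_space)
  show "src (zero_mor C X Y) = X" "tgt (zero_mor C X Y) = Y"
    using M.zero_closed[of X Y] by (auto simp: hom_space_def hom_iff)
  show "src (c \<bullet> f) = src f" "tgt (c \<bullet> f) = tgt f"
    using M.smult_closed[of c f "src f" "tgt f"] by (auto simp: hom_space_def hom_iff ground_ring_def)
  show "src (f \<boxplus> g) = src g" "tgt (f \<boxplus> g) = tgt g" if "src f = src g" "tgt f = tgt g"
    using that M.add.m_closed[of f "src f" "tgt f" g] by (auto simp: hom_space_def hom_iff)
qed

lemma scale_one [simp]: "1 \<bullet> f = f"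
  and scale_zero: "0 \<bullet> f = zero_mor C (src f) (tgt f)"
  and scale_scale [simp]: "c \<bullet> (d \<bullet> f) = (c * d) \<bullet> f"
  and scale_add: "(c + d) \<bullet> f = (c \<bullet> f) \<boxplus> (d \<bullet> f)"
proof -
  interpret M: Module.module ground_ring "hom_space C U V" for U V
    by (rule hom_vector_space)
  show "1 \<bullet> f = f" "0 \<bullet> f = zero_mor C (src f) (tgt f)"
    "c \<bullet> (d \<bullet> f) = (c * d) \<bullet> f" "(c + d) \<bullet> f = (c \<bullet> f) \<boxplus> (d \<bullet> f)"
    using M.smult_one[of f "src f" "tgt f"] M.smult_l_null[of f "src f" "tgt f"]
      M.smult_assoc1[of c d f "src f" "tgt f"] M.smult_l_distr[of c d f "src f" "tgt f"]
    by (auto simp: hom_space_def hom_iff ground_ring_def)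
qed

lemma comp_scale [simp]:
  "tgt f = src g \<Longrightarrow> g \<cdot> (c \<bullet> f) = c \<bullet> (g \<cdot> f)"
  "tgt f = src g \<Longrightarrow> (c \<bullet> g) \<cdot> f = c \<bullet> (g \<cdot> f)"
  using compose_scale_right[of f "src f" "tgt f" g "tgt g" c]
    compose_scale_left[of f "src f" "tgt f" g "tgt g" c] by (auto simp: hom_iff)

lemma comp_plus:
  "\<lbrakk>src f = src f'; tgt f = tgt f'; tgt f' = src g\<rbrakk> \<Longrightarrow> g \<cdot> (f \<boxplus> f') = (g \<cdot> f) \<boxplus> (g \<cdot> f')"
  "\<lbrakk>src g = src g'; tgt g = tgt g'; tgt f = src g'\<rbrakk> \<Longrightarrow> (g \<boxplus> g') \<cdot> f = (g \<cdot> f) \<boxplus> (g' \<cdot> f)"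
  using compose_plus_right[of f "src f'" "tgt f'" f' g "tgt g"]
    compose_plus_left[of f "src f" "tgt f" g "tgt g'" g'] by (auto simp: hom_iff)

abbreviation mor_sum where "mor_sum X Y fs \<equiv> foldr (\<boxplus>) fs (zero_mor C X Y)"

lemma mor_sum_hom [simp]:
  "\<forall>f\<in>set fs. src f = X \<and> tgt f = Y \<Longrightarrow> src (mor_sum X Y fs) = X"
  "\<forall>f\<in>set fs. src f = X \<and> tgt f = Y \<Longrightarrow> tgt (mor_sum X Y fs) = Y"
proof (induction fs)
  case (Cons f fs)
  { case 1 then show ?case using Cons.IH by simp }
  { case 2 then show ?case using Cons.IH by simp }
qed simp_all

lemma mor_sum_linear:
  assumes "\<And>f g. \<lbrakk>f \<in> hom_set C X Y; g \<in> hom_set C X Y\<rbrakk> \<Longrightarrow> F (f \<boxplus> g) = F f \<boxplus> F g"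
    and "\<And>f c. f \<in> hom_set C X Y \<Longrightarrow> F (c \<bullet> f) = c \<bullet> F f"
    and "\<And>f. f \<in> hom_set C X Y \<Longrightarrow> F f \<in> hom_set C V W"
    and "set fs \<subseteq> hom_set C X Y"
  shows "F (mor_sum X Y fs) = mor_sum V W (map F fs)"
  using assms(4)
proof (induction fs)
  case Nil
  \<comment> \<open>Linearity is only known on hom-sets; that \<open>F\<close> preserves zero comes
    from homogeneity with the scalar 0.\<close>
  have "F (0 \<bullet> zero_mor C X Y) = 0 \<bullet> F (zero_mor C X Y)"
    by (rule assms(2)) (simp add: hom_iff)
  moreover have "F (zero_mor C X Y) \<in> hom_set C V W"
    by (rule assms(3)) (simp add: hom_iff)
  ultimately show ?case by (simp add: scale_zero hom_iff)
next
  case (Cons f fs)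
  then have "mor_sum X Y fs \<in> hom_set C X Y"
    by (auto simp: hom_iff subset_iff intro!: mor_sum_hom)
  with Cons show ?case by (simp add: assms(1))
qed

end

context tensor_category
begin

lemma tensored_linear [simp]:
  "(c \<bullet> f) \<lhd> W = c \<bullet> (f \<lhd> W)" "W \<rhd> (c \<bullet> f) = c \<bullet> (W \<rhd> f)"
  using tensor_scale_left[of f "src f" "tgt f" "idm W" W W c]
    tensor_scale_right[of "idm W" W W f "src f" "tgt f" c]
  by (auto simp: hom_iff tensored_def whisker_def)

lemma tensored_plus:
  "\<lbrakk>src f = src g; tgt f = tgt g\<rbrakk> \<Longrightarrow> (f \<boxplus> g) \<lhd> W = (f \<lhd> W) \<boxplus> (g \<lhd> W)"
  using tensor_plus_left[of f "src g" "tgt g" g "idm W" W W] by (auto simp: hom_iff tensored_def)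

end

section \<open>Connected separable algebras\<close>

locale connected_separable_algebra = spherical_tensor_category C
  for C :: "('o, 'm, 'k::field, 'z) spherical_data_scheme" (structure) +
  fixes A :: 'o and m \<iota> :: 'm
  assumes separable: "separable_algebra C A m \<iota>" and connected: "connected_algebra C A \<iota>"
begin

section \<open>The algebra in operator form and the symmetry of its pairing\<close>

definition mul where "mul W = app2 m A A W"
definition unt where "unt W = (\<iota> \<lhd> W) \<cdot> \<l>' W"
definition \<epsilon> where "\<epsilon> = canonical_trace C A m"
definition trc where "trc W = \<l> W \<cdot> (\<epsilon> \<lhd> W)"
definition pairing where "pairing W = trc W \<cdot> mul W"
definition copair where "copair W = cup (kappa C A m) A A W"

lemma algebra: "algebra_in C A m \<iota>"
  using separable by (simp add: separable_algebra_def)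

lemma alg_simps [simp]: "src m = A \<boxtimes> A" "tgt m = A" "src \<iota> = \<I>" "tgt \<iota> = A"
  using algebra by (auto simp: algebra_in_def hom_iff)

lemma \<epsilon>_simps [simp]: "src \<epsilon> = A" "tgt \<epsilon> = \<I>"
  by (simp_all add: \<epsilon>_def canonical_trace_def)

lemma copairing_kappa: "copairing C A m (kappa C A m)"
  using separable unfolding separable_algebra_def kappa_def by (meson someI_ex)

lemma kappa_simps [simp]: "src (kappa C A m) = \<I>" "tgt (kappa C A m) = A \<boxtimes> A"
  using copairing_kappa by (auto simp: copairing_def hom_iff)

lemma op_simps [simp]:
  "src (mul W) = A \<boxtimes> A \<boxtimes> W" "tgt (mul W) = A \<boxtimes> W"
  "src (unt W) = W" "tgt (unt W) = A \<boxtimes> W"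
  "src (trc W) = A \<boxtimes> W" "tgt (trc W) = W"
  "src (pairing W) = A \<boxtimes> A \<boxtimes> W" "tgt (pairing W) = W"
  "src (copair W) = W" "tgt (copair W) = A \<boxtimes> A \<boxtimes> W"
  by (simp_all add: mul_def unt_def trc_def pairing_def copair_def)

lemma mul_nat: "\<lbrakk>src f = V; tgt f = W\<rbrakk> \<Longrightarrow> mul W \<cdot> (A \<rhd> A \<rhd> f) = (A \<rhd> f) \<cdot> mul V"
  using app2_nat[of m A A f V W] by (simp add: mul_def)

lemma unt_nat: "\<lbrakk>src f = V; tgt f = W\<rbrakk> \<Longrightarrow> unt W \<cdot> f = (A \<rhd> f) \<cdot> unt V"
  by (simp add: unt_def lunit_inv_nat comp_rewrite2[OF interchange'])

lemma trc_nat: "\<lbrakk>src f = V; tgt f = W\<rbrakk> \<Longrightarrow> trc W \<cdot> (A \<rhd> f) = f \<cdot> trc V"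
  by (simp add: trc_def interchange' comp_rewrite2[OF lunit_nat])

lemma pairing_nat: "\<lbrakk>src f = V; tgt f = W\<rbrakk> \<Longrightarrow> pairing W \<cdot> (A \<rhd> A \<rhd> f) = f \<cdot> pairing V"
  by (simp add: pairing_def mul_nat comp_rewrite2[OF trc_nat])

lemma copair_nat: "\<lbrakk>src f = V; tgt f = W\<rbrakk> \<Longrightarrow> copair W \<cdot> f = (A \<rhd> A \<rhd> f) \<cdot> copair V"
  using cup_nat[of "kappa C A m" A A f V W] by (simp add: copair_def)

lemma head_nat: "\<lbrakk>src f = A; tgt f = A; src g = V; tgt g = W\<rbrakk> \<Longrightarrow> (f \<lhd> W) \<cdot> (A \<rhd> g) = (A \<rhd> g) \<cdot>
      (f \<lhd> V)"
  by (rule interchange')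

lemma mul_assoc: "mul W \<cdot> mul (A \<boxtimes> W) = mul W \<cdot> (A \<rhd> mul W)"
proof -
  have eq: "m \<cdot> (m \<lhd> A) \<cdot> \<alpha>' A A A = m \<cdot> (A \<rhd> m)"
  proof -
    have "m \<cdot> (m \<lhd> A) \<cdot> \<alpha>' A A A = m \<cdot> (A \<rhd> m) \<cdot> \<alpha> A A A \<cdot> \<alpha>' A A A"
      using algebra by (simp add: algebra_in_def whisker_def tensored_def)
    then show ?thesis by simp
  qed
  have "mul W \<cdot> mul (A \<boxtimes> W) = (m \<lhd> W) \<cdot> (((m \<lhd> A) \<lhd> W) \<cdot> (\<alpha>' (A \<boxtimes> A) A W \<cdot> \<alpha>' A A (A \<boxtimes> W)))"
    by (simp add: mul_def app2_def comp_rewrite2[OF assoc_inv_nat1])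
  also have "\<dots> = ((m \<cdot> (m \<lhd> A) \<cdot> \<alpha>' A A A) \<lhd> W) \<cdot> (\<alpha>' A (A \<boxtimes> A) W \<cdot> (A \<rhd> \<alpha>' A A W))"
    by (simp add: assoc_inv_pentagon)
  also have "\<dots> = mul W \<cdot> (A \<rhd> mul W)"
    unfolding eq by (simp add: mul_def app2_def comp_rewrite2[OF assoc_inv_nat2])
  finally show ?thesis .
qed

lemma mul_unt_left: "mul W \<cdot> unt (A \<boxtimes> W) = idm (A \<boxtimes> W)"
proof -
  have eq: "m \<cdot> (\<iota> \<lhd> A) = \<l> A"
    using algebra by (simp add: algebra_in_def tensored_def)
  have "mul W \<cdot> unt (A \<boxtimes> W) = ((m \<cdot> (\<iota> \<lhd> A)) \<lhd> W) \<cdot> (\<l>' A \<lhd> W)"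
    by (simp add: mul_def app2_def unt_def comp_rewrite2[OF assoc_inv_nat1] flip: lunit_inv_tensor)
  then show ?thesis unfolding eq by (simp add: tensored_inverse)
qed

lemma mul_unt_right: "mul W \<cdot> (A \<rhd> unt W) = idm (A \<boxtimes> W)"
proof -
  have eq: "m \<cdot> (A \<rhd> \<iota>) = \<r> A"
    using algebra by (simp add: algebra_in_def whisker_def)
  have "mul W \<cdot> (A \<rhd> unt W) = ((m \<cdot> (A \<rhd> \<iota>)) \<lhd> W) \<cdot> (\<r>' A \<lhd> W)"
    by (simp add: mul_def app2_def unt_def comp_rewrite2[OF assoc_inv_nat2] flip: triangle_inv)
  then show ?thesis unfolding eq by (simp add: tensored_inverse)
qed

lemma pairing_eq: "pairing W = cap (canonical_pairing C A m) A A W"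
  by (simp add: pairing_def trc_def mul_def cap_def app2_def canonical_pairing_def \<epsilon>_def[symmetric])

lemma pairing_copair: "pairing (A \<boxtimes> W) \<cdot> (A \<rhd> copair W) = idm (A \<boxtimes> W)"
proof -
  have [simp]: "src (canonical_pairing C A m) = A \<boxtimes> A" "tgt (canonical_pairing C A m) = \<I>"
    by (simp_all add: canonical_pairing_def \<epsilon>_def[symmetric])
  show ?thesis
    using copairing_kappa unfolding pairing_eq copair_def
    by (simp add: cap_cup copairing_def whisker_def[symmetric] tensored_def[symmetric])
qed

lemma pairing_assoc: "pairing W \<cdot> mul (A \<boxtimes> W) = pairing W \<cdot> (A \<rhd> mul W)"
  by (simp add: pairing_def mul_assoc)

text \<open>The canonical trace sends \<open>x\<close> to the trace of left multiplication by
  \<open>x\<close>, closed up with the second duality; in this form it can be rotated.\<close>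

lemma trc_eq: "trc W = sevc A W \<cdot> (mul (dl A \<boxtimes> W) \<cdot> (A \<rhd> coc A W))"
proof -
  have "trc W = \<l> W \<cdot> ((sph_ev A \<lhd> W) \<cdot> (((m \<lhd> dl A) \<cdot> (\<alpha>' A A (dl A) \<cdot> ((A \<rhd> coev C A) \<cdot>
        \<r>' A))) \<lhd> W))"
    by (simp add: trc_def \<epsilon>_def canonical_trace_def sph_ev_def whisker_def[symmetric] tensored_def[symmetric])
  also have "\<dots> = sevc A W \<cdot> (\<alpha> A (dl A) W \<cdot> (((m \<lhd> dl A) \<cdot> (\<alpha>' A A (dl A) \<cdot> ((A \<rhd> coev C A) \<cdot>
        \<r>' A))) \<lhd> W))"
    by (simp add: cap_def app2_def)
  also have "\<dots> = sevc A W \<cdot> (mul (dl A \<boxtimes> W) \<cdot> (A \<rhd> coc A W))"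
    using app2_cup[of m A A "coev C A" "dl A" W] by (simp add: mul_def)
  finally show ?thesis .
qed

text \<open>The map \<open>a \<mapsto> b(a, -)\<close> from \<open>A\<close> to its dual, acting on
  the head of a word.\<close>

definition flat where "flat W = pairing (dl A \<boxtimes> W) \<cdot> (A \<rhd> coc A W)"

lemma flat_simps [simp]: "src (flat W) = A \<boxtimes> W" "tgt (flat W) = dl A \<boxtimes> W"
  by (simp_all add: flat_def)

text \<open>The symmetry of the pairing: \<open>b(x, y) = tr (f g)\<close> for \<open>f = m : A \<otimes> A \<rightarrow> A\<close> and \<open>g a = x \<otimes> y a\<close>, and the
  right-hand side is \<open>tr (g f)\<close> with the trace over \<open>A \<otimes> A\<close> written as two nested traces over \<open>A\<close>.\<close>

lemma pairing_flat: "pairing W = sevc A W \<cdot> (A \<rhd> flat W)"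
proof -
  let ?Z = "A \<boxtimes> A" and ?D = "dual_mor C m" and ?J = "dual_join A A W"
  let ?n = "(A \<rhd> coc A (dl A \<boxtimes> W)) \<cdot> coc A W"
  have mul_split: "(m \<lhd> W) \<cdot> \<alpha>' A A W = mul W" for W by (simp add: mul_def app2_def)
  \<comment> \<open>The dual of \<open>m\<close> on the coevaluation of \<open>A\<close> is
    \<open>m\<close> on the coevaluation of \<open>A \<boxtimes> A\<close>, which
    \<open>coc_tensor\<close> splits into two nested ones.\<close>
  have coc_m: "(A \<rhd> (?D \<lhd> W)) \<cdot> coc A W = mul (dl ?Z \<boxtimes> W) \<cdot> ((A \<rhd> A \<rhd> ?J) \<cdot> ?n)"
    using dual_coc[of m ?Z A W] by (simp add: coc_tensor comp_rewrite[OF mul_split])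
  have "pairing W = sevc A W \<cdot> (mul (dl A \<boxtimes> W) \<cdot> (mul (A \<boxtimes> dl A \<boxtimes> W) \<cdot> (A \<rhd> A \<rhd> coc A W)))"
    by (simp add: pairing_def trc_eq mul_nat[symmetric])
  also have "\<dots> = sevc A W \<cdot> ((m \<lhd> dl A \<boxtimes> W) \<cdot> (\<alpha>' A A (dl A \<boxtimes> W) \<cdot>
      ((A \<rhd> mul (dl A \<boxtimes> W)) \<cdot> (A \<rhd> A \<rhd> coc A W))))"
    by (simp add: comp_rewrite2[OF mul_assoc]) (simp add: mul_def[of "dl A \<boxtimes> W"] app2_def[of m])
  \<comment> \<open>The outer product crosses the evaluation as its dual, so that the trace now runs
    over \<open>A \<boxtimes> A\<close>.\<close>
  also have "\<dots> = sevc ?Z W \<cdot> ((?Z \<rhd> (?D \<lhd> W)) \<cdot> (\<alpha>' A A (dl A \<boxtimes> W) \<cdot>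
      ((A \<rhd> mul (dl A \<boxtimes> W)) \<cdot> (A \<rhd> A \<rhd> coc A W))))"
    by (simp add: comp_rewrite2[OF sevc_dual])
  also have "\<dots> = sevc ?Z W \<cdot> (\<alpha>' A A (dl ?Z \<boxtimes> W) \<cdot> (A \<rhd> ((A \<rhd> (?D \<lhd> W)) \<cdot> mul (dl A \<boxtimes> W)))
      \<cdot> (A \<rhd> A \<rhd> coc A W))"
    by (simp add: comp_rewrite2[OF assoc_inv_nat3[symmetric]])
  also have "\<dots> = sevc ?Z W \<cdot> (\<alpha>' A A (dl ?Z \<boxtimes> W) \<cdot> ((A \<rhd> mul (dl ?Z \<boxtimes> W)) \<cdot>
      (A \<rhd> A \<rhd> ((A \<rhd> (?D \<lhd> W)) \<cdot> coc A W))))"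
    by (simp add: mul_nat[symmetric])
  also have "\<dots> = sevc ?Z W \<cdot> (\<alpha>' A A (dl ?Z \<boxtimes> W) \<cdot> (A \<rhd> (mul (dl ?Z \<boxtimes> W) \<cdot>
      (A \<rhd> (mul (dl ?Z \<boxtimes> W) \<cdot> (A \<rhd> A \<rhd> ?J))))) \<cdot> (A \<rhd> A \<rhd> ?n))"
    unfolding coc_m by simp
  also have "\<dots> = sevc ?Z W \<cdot> (\<alpha>' A A (dl ?Z \<boxtimes> W) \<cdot> ((A \<rhd> A \<rhd> ?J) \<cdot>
      ((A \<rhd> (mul (dl A \<boxtimes> dl A \<boxtimes> W) \<cdot> (A \<rhd> mul (dl A \<boxtimes> dl A \<boxtimes> W)))) \<cdot> (A \<rhd> A \<rhd> ?n))))"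
    by (simp add: mul_nat comp_rewrite2[OF whisker_rewrite[OF mul_nat]])
  \<comment> \<open>\<open>sevc_tensor\<close> splits the trace again; the inner one computes
    \<open>\<epsilon>(y a) = b(y, a)\<close>, which is \<open>flat\<close> of
    \<open>y\<close>.\<close>
  also have "\<dots> = sevc A W \<cdot> ((A \<rhd> sevc A (dl A \<boxtimes> W)) \<cdot>
      ((A \<rhd> (mul (dl A \<boxtimes> dl A \<boxtimes> W) \<cdot> (A \<rhd> mul (dl A \<boxtimes> dl A \<boxtimes> W)))) \<cdot> (A \<rhd> A \<rhd> ?n)))"
    by (simp add: comp_rewrite2[OF assoc_inv_nat3] comp_rewrite3[OF sevc_tensor])
  also have "\<dots> = sevc A W \<cdot> (A \<rhd> flat W)"
    by (simp add: flat_def pairing_def trc_eq mul_nat[symmetric] mul_assoc[symmetric]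
        comp_rewrite2[OF mul_assoc[symmetric]])
  finally show ?thesis .
qed

end

section \<open>Non-degeneracy of the pairing and invariance of the copairing\<close>

context connected_separable_algebra
begin

text \<open>The map \<open>\<phi> \<mapsto> (\<phi> \<otimes> 1) \<kappa>\<close> back from the
  dual, a left inverse of \<open>flat\<close> by the first zigzag identity.\<close>

definition sharp where "sharp W = evc A (A \<boxtimes> W) \<cdot> (dl A \<rhd> copair W)"

lemma sharp_simps [simp]: "src (sharp W) = dl A \<boxtimes> W" "tgt (sharp W) = A \<boxtimes> W"
  by (simp_all add: sharp_def)

lemma evc_flat: "evc A W \<cdot> flat (A \<boxtimes> W) = pairing W"
proof -
  have "evc A W \<cdot> flat (A \<boxtimes> W) = pairing W \<cdot> ((A \<rhd> A \<rhd> evc A W) \<cdot> (A \<rhd> coc A (A \<boxtimes> W)))"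
    by (simp add: flat_def comp_rewrite2[OF pairing_nat])
  then show ?thesis by (simp add: evc_coc flip: whisker_comp)
qed

lemma flat_nat: "\<lbrakk>src f = V; tgt f = W\<rbrakk> \<Longrightarrow> flat W \<cdot> (A \<rhd> f) = (dl A \<rhd> f) \<cdot> flat V"
  by (simp add: flat_def comp_rewrite2[OF pairing_nat[symmetric]] cup_nat
      whisker_rewrite[OF cup_nat])

lemma sharp_flat: "sharp W \<cdot> flat W = idm (A \<boxtimes> W)"
  by (simp add: sharp_def flat_nat[symmetric] comp_rewrite[OF evc_flat] pairing_copair)

text \<open>Bending the first argument of the pairing in the second duality gives
  \<open>a \<mapsto> b(-, a)\<close>; by \<open>pairing_flat\<close> this is again
  \<open>a \<mapsto> b(a, -)\<close>.\<close>

lemma flat_eq: "flat W = (dl A \<rhd> pairing W) \<cdot> scoc A (A \<boxtimes> W)"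
proof -
  have "(dl A \<rhd> pairing W) \<cdot> scoc A (A \<boxtimes> W) =
      (dl A \<rhd> sevc A W) \<cdot> ((dl A \<rhd> A \<rhd> flat W) \<cdot> scoc A (A \<boxtimes> W))"
    by (simp add: pairing_flat)
  also have "\<dots> = (dl A \<rhd> sevc A W) \<cdot> (scoc A (dl A \<boxtimes> W) \<cdot> flat W)"
    using cup_nat[of "sph_coev A" "dl A" A "flat W" "A \<boxtimes> W" "dl A \<boxtimes> W"] by simp
  also have "\<dots> = flat W"
    by (simp add: comp_rewrite[OF sevc_scoc])
  finally show ?thesis by simp
qed

text \<open>The second zigzag identity. Only the first one is part of the definition of \<open>kappa\<close>; the two are
  linked by the symmetry \<open>pairing_flat\<close> of the pairing, i.e. by the cyclicity of the trace.\<close>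

lemma copair_pairing: "(A \<rhd> pairing W) \<cdot> copair (A \<boxtimes> W) = idm (A \<boxtimes> W)"
proof -
  let ?P = "(A \<rhd> pairing W) \<cdot> copair (A \<boxtimes> W)"
  have "pairing W \<cdot> (A \<rhd> ?P) = pairing W \<cdot> (pairing (A \<boxtimes> A \<boxtimes> W) \<cdot> (A \<rhd> copair (A \<boxtimes> W)))"
    by (simp add: comp_rewrite2[OF pairing_nat])
  also have "\<dots> = pairing W"
    by (simp add: pairing_copair)
  finally have P: "pairing W \<cdot> (A \<rhd> ?P) = pairing W" .
  \<comment> \<open>By \<open>flat_eq\<close>, \<open>flat\<close> sees its argument through the
    second slot of the pairing, where \<open>?P\<close> acts as the identity by \<open>P\<close>;
    \<open>sharp\<close> then cancels \<open>flat\<close>.\<close>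
  have "flat W \<cdot> ?P = (dl A \<rhd> pairing W) \<cdot> (scoc A (A \<boxtimes> W) \<cdot> ?P)"
    by (simp add: flat_eq)
  also have "\<dots> = (dl A \<rhd> (pairing W \<cdot> (A \<rhd> ?P))) \<cdot> scoc A (A \<boxtimes> W)"
    using cup_nat[of "sph_coev A" "dl A" A ?P "A \<boxtimes> W" "A \<boxtimes> W"] by simp
  also have "\<dots> = flat W"
    unfolding P by (simp add: flat_eq)
  finally have "sharp W \<cdot> (flat W \<cdot> ?P) = sharp W \<cdot> flat W" by simp
  then show ?thesis by (simp add: comp_rewrite[OF sharp_flat] sharp_flat)
qed

text \<open>By \<open>copair_pairing\<close> it suffices to compare pairings with an arbitrary
  \<open>x\<close>: \<open>b(x, a \<kappa>\<^sub>1) \<kappa>\<^sub>2 = b(x a, \<kappa>\<^sub>1)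
  \<kappa>\<^sub>2 = x a\<close>.\<close>

lemma mul_copair: "mul (A \<boxtimes> W) \<cdot> (A \<rhd> copair W) = (A \<rhd> mul W) \<cdot> copair (A \<boxtimes> W)"
proof -
  let ?Y = "A \<boxtimes> W"
  have "mul ?Y \<cdot> (A \<rhd> copair W) = (A \<rhd> pairing ?Y) \<cdot> (copair (A \<boxtimes> ?Y) \<cdot> (mul ?Y \<cdot> (A \<rhd> copair W)))"
    by (simp add: comp_rewrite[OF copair_pairing])
  also have "\<dots> = (A \<rhd> (pairing ?Y \<cdot> (A \<rhd> (mul ?Y \<cdot> (A \<rhd> copair W))))) \<cdot> copair ?Y"
    using copair_nat[of "mul ?Y \<cdot> (A \<rhd> copair W)" "A \<boxtimes> W" "A \<boxtimes> ?Y"] by simp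
  also have "pairing ?Y \<cdot> (A \<rhd> (mul ?Y \<cdot> (A \<rhd> copair W))) = pairing ?Y \<cdot> ((A \<rhd> copair W) \<cdot> mul W)"
    by (simp add: comp_rewrite2[OF pairing_assoc[symmetric]] mul_nat)
  also have "\<dots> = mul W"
    by (simp add: comp_rewrite[OF pairing_copair])
  finally show ?thesis .
qed

text \<open>Turning the second factor of \<open>\<kappa>\<close> into a functional by
  \<open>flat\<close> yields the coevaluation, so the pairing of \<open>x\<close> with
  \<open>\<kappa>\<^sub>1 \<kappa>\<^sub>2\<close> is the trace of left multiplication by
  \<open>x\<close>.\<close>

lemma pairing_mul_copair: "pairing W \<cdot> (A \<rhd> (mul W \<cdot> copair W)) = trc W"
proof -
  have flat_copair: "(A \<rhd> flat W) \<cdot> copair W = coc A W"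
    using copair_nat[of "coc A W" W "A \<boxtimes> dl A \<boxtimes> W", symmetric]
    by (simp add: flat_def comp_rewrite[OF copair_pairing])
  have "pairing W \<cdot> (A \<rhd> (mul W \<cdot> copair W)) = pairing W \<cdot> (mul (A \<boxtimes> W) \<cdot> (A \<rhd> copair W))"
    by (simp add: comp_rewrite2[OF pairing_assoc])
  also have "\<dots> = sevc A W \<cdot> (mul (dl A \<boxtimes> W) \<cdot> (A \<rhd> ((A \<rhd> flat W) \<cdot> copair W)))"
    by (simp add: pairing_flat comp_rewrite2[OF mul_nat])
  also have "\<dots> = trc W"
    by (simp only: flat_copair trc_eq)
  finally show ?thesis .
qed

section \<open>The character \<open>T\<close> of the convolution algebra\<close>

definition loop where "loop f = m \<cdot> ((f \<lhd> A) \<cdot> kappa C A m)"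
definition T where "T f = (THE c. loop f = c \<bullet> \<iota>)"

abbreviation endo where "endo f \<equiv> src f = A \<and> tgt f = A"

lemma \<iota>_scale_inj: "c \<bullet> \<iota> = d \<bullet> \<iota> \<longleftrightarrow> c = d"
proof
  assume eq: "c \<bullet> \<iota> = d \<bullet> \<iota>"
  have nz: "\<iota> \<noteq> 0 \<bullet> \<iota>"
    using connected by (simp add: connected_algebra_def scale_zero)
  show "c = d"
  proof (rule ccontr)
    assume ne: "c \<noteq> d"
    have "(c - d) \<bullet> \<iota> = (c \<bullet> \<iota>) \<boxplus> ((-d) \<bullet> \<iota>)"
      using scale_add[of c "-d" \<iota>] by simp
    also have "\<dots> = 0 \<bullet> \<iota>"
      using scale_add[of d "-d" \<iota>] by (simp add: eq)
    finally have "inverse (c - d) \<bullet> ((c - d) \<bullet> \<iota>) = inverse (c - d) \<bullet> (0 \<bullet> \<iota>)" by simp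
    then show False using nz ne by simp
  qed
qed simp

lemma T_eqI: "loop f = c \<bullet> \<iota> \<Longrightarrow> T f = c"
  unfolding T_def by (auto simp: \<iota>_scale_inj)

lemma loop_T: "endo f \<Longrightarrow> loop f = T f \<bullet> \<iota>"
proof -
  assume "endo f"
  then have "loop f \<in> hom_set C \<I> A" by (simp add: loop_def hom_iff)
  then obtain c where "loop f = c \<bullet> \<iota>"
    using connected unfolding connected_algebra_def by auto
  then show ?thesis using T_eqI by metis
qed

lemma loop_op: "endo f \<Longrightarrow> (loop f \<lhd> W) \<cdot> \<l>' W = mul W \<cdot> ((f \<lhd> A \<boxtimes> W) \<cdot> copair W)"
  by (simp add: loop_def mul_def app2_def copair_def cup_def comp_rewrite2[OF assoc_inv_nat1])

lemma mul_loop: "endo f \<Longrightarrow> mul W \<cdot> ((f \<lhd> A \<boxtimes> W) \<cdot> copair W) = T f \<bullet> unt W"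
  using loop_op[of f W] by (simp add: loop_T unt_def)

text \<open>The way back from operators to morphisms out of \<open>\<I>\<close>: the tail
  \<open>\<I>\<close> already separates them.\<close>

lemma op_inj:
  assumes "(f \<lhd> \<I>) \<cdot> \<l>' \<I> = (g \<lhd> \<I>) \<cdot> \<l>' \<I>" "src f = \<I>" "src g = \<I>" "tgt f = tgt g"
  shows "f = g"
proof -
  have "((f \<lhd> \<I>) \<cdot> \<l>' \<I>) \<cdot> \<l> \<I> = ((g \<lhd> \<I>) \<cdot> \<l>' \<I>) \<cdot> \<l> \<I>"
    by (simp only: assms(1))
  then have "f \<lhd> \<I> = g \<lhd> \<I>" using assms(2-4) by simp
  then show ?thesis using assms(2-4) tensored_unit_inj[of f g] by simp
qed

lemma T_eqI_op:
  assumes "endo f" "\<And>W. mul W \<cdot> ((f \<lhd> A \<boxtimes> W) \<cdot> copair W) = c \<bullet> unt W"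
  shows "T f = c"
proof (rule T_eqI, rule op_inj)
  show "(loop f \<lhd> \<I>) \<cdot> \<l>' \<I> = ((c \<bullet> \<iota>) \<lhd> \<I>) \<cdot> \<l>' \<I>"
    using assms(2)[of \<I>] by (simp add: loop_op[OF assms(1)] unt_def)
qed (use assms in \<open>simp_all add: loop_def\<close>)

text \<open>Otherwise \<open>pairing_mul_copair\<close> makes the canonical trace zero, hence the
  pairing, hence by \<open>pairing_copair\<close> the identity of \<open>A\<close>, against
  \<open>\<iota>\<close> being non-zero.\<close>

lemma T_ident_nonzero: "T (idm A) \<noteq> 0"
proof
  assume "T (idm A) = 0"
  then have "mul W \<cdot> copair W = 0 \<bullet> unt W" for W
    using mul_loop[of "idm A" W] by simp
  then have "trc W = 0 \<bullet> trc W" for W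
    using pairing_mul_copair[of W] by (simp add: pairing_def mul_unt_right)
  then have "idm (A \<boxtimes> \<I>) = 0 \<bullet> idm (A \<boxtimes> \<I>)"
    using pairing_copair[of \<I>] unfolding pairing_def
    by (metis comp_scale(2) op_simps(1,2,5,6) scale_scale mult_zero_left src_comp tgt_comp whisker_simps(1,2)
        op_simps(10))
  then have "idm A \<lhd> \<I> = (0 \<bullet> idm A) \<lhd> \<I>"
    by simp
  then have "idm A = 0 \<bullet> idm A"
    by (rule tensored_unit_inj) simp_all
  then have "1 \<bullet> \<iota> = 0 \<bullet> \<iota>"
    by (metis alg_simps(4) comp_scale(2) ident_comp scale_one src_ident)
  then show False by (simp only: \<iota>_scale_inj) simp
qed

lemma T_linear:
  "endo f \<Longrightarrow> T (c \<bullet> f) = c * T f"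
  "\<lbrakk>endo f; endo g\<rbrakk> \<Longrightarrow> T (f \<boxplus> g) = T f + T g"
proof -
  show "T (c \<bullet> f) = c * T f" if "endo f"
    by (rule T_eqI) (use loop_T[OF that] that in \<open>simp add: loop_def\<close>)
  show "T (f \<boxplus> g) = T f + T g" if "endo f" "endo g"
    by (rule T_eqI) (use loop_T[OF that(1)] loop_T[OF that(2)] that in
        \<open>simp add: loop_def tensored_plus comp_plus scale_add\<close>)
qed

lemma T_zero: "T (zero_mor C A A) = 0"
  using T_linear(1)[of "idm A" 0] by (simp add: scale_zero)

lemma T_sum: "\<forall>f\<in>set fs. endo f \<Longrightarrow> T (mor_sum A A fs) = (\<Sum>f\<leftarrow>fs. T f)"
  by (induction fs) (simp_all add: T_zero T_linear)

definition conv where "conv f g = m \<cdot> (f \<star> g) \<cdot> dual_mult C A m"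

lemma dual_mult_simps [simp]: "src (dual_mult C A m) = A" "tgt (dual_mult C A m) = A \<boxtimes> A"
  by (simp_all add: dual_mult_def)

lemma conv_endo: "\<lbrakk>endo f; endo g\<rbrakk> \<Longrightarrow> endo (conv f g)"
  by (simp add: conv_def)

text \<open>\<open>dual_mult\<close> sends \<open>a\<close> to
  \<open>a \<kappa>\<^sub>1 \<otimes> \<kappa>\<^sub>2\<close>; by invariance this is
  \<open>\<kappa>\<^sub>1 \<otimes> \<kappa>\<^sub>2 a\<close>, so \<open>conv f g\<close> is
  \<open>a \<mapsto> f(\<kappa>\<^sub>1) g(\<kappa>\<^sub>2 a)\<close>.\<close>

lemma conv_op:
  assumes "endo f" "endo g"
  shows "conv f g \<lhd> W = mul W \<cdot> ((f \<lhd> A \<boxtimes> W) \<cdot> ((A \<rhd> (g \<lhd> W)) \<cdot> ((A \<rhd> mul W) \<cdot> copair (A \<boxtimes> W))))"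
proof -
  have dm: "\<alpha> A A W \<cdot> (dual_mult C A m \<lhd> W) = mul (A \<boxtimes> W) \<cdot> (A \<rhd> copair W)"
    using app2_cup[of m A A "kappa C A m" A W]
    by (simp add: dual_mult_def mul_def copair_def whisker_def[symmetric] tensored_def[symmetric])
  have "conv f g \<lhd> W = mul W \<cdot> (\<alpha> A A W \<cdot> (((f \<star> g) \<lhd> W) \<cdot> (dual_mult C A m \<lhd> W)))"
    using assms by (simp add: conv_def mul_def app2_def)
  also have "\<dots> = mul W \<cdot> ((A \<rhd> (g \<lhd> W)) \<cdot> ((f \<lhd> A \<boxtimes> W) \<cdot> (\<alpha> A A W \<cdot> (dual_mult C A m \<lhd> W))))"
    using assms by (simp add: tensor_whiskers comp_rewrite2[OF assoc_nat2]
          comp_rewrite2[OF assoc_nat1])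
  finally show ?thesis
    using assms by (simp add: dm mul_copair comp_rewrite2[OF head_nat])
qed

lemma mul_loop_left:
  assumes "endo g"
  shows "mul W \<cdot> ((g \<lhd> A \<boxtimes> W) \<cdot> ((A \<rhd> mul W) \<cdot> copair (A \<boxtimes> W))) = T g \<bullet> idm (A \<boxtimes> W)"
proof -
  have "mul W \<cdot> ((g \<lhd> A \<boxtimes> W) \<cdot> ((A \<rhd> mul W) \<cdot> copair (A \<boxtimes> W))) =
      mul W \<cdot> ((A \<rhd> mul W) \<cdot> ((g \<lhd> A \<boxtimes> A \<boxtimes> W) \<cdot> copair (A \<boxtimes> W)))"
    using assms by (simp add: comp_rewrite2[OF head_nat])
  also have "\<dots> = mul W \<cdot> (mul (A \<boxtimes> W) \<cdot> ((g \<lhd> A \<boxtimes> A \<boxtimes> W) \<cdot> copair (A \<boxtimes> W)))"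
    using assms by (simp add: comp_rewrite2[OF mul_assoc])
  also have "\<dots> = T g \<bullet> idm (A \<boxtimes> W)"
    using assms by (simp add: mul_loop mul_unt_left)
  finally show ?thesis .
qed

text \<open>With a second copy \<open>\<kappa>'\<close>, the loop of \<open>conv f g\<close> is
  \<open>f(\<kappa>\<^sub>1) g(\<kappa>\<^sub>2 \<kappa>'\<^sub>1) \<kappa>'\<^sub>2\<close>.
  Invariance moves \<open>\<kappa>\<^sub>2\<close> to the far right; the \<open>g\<close>-loop
  collapses to \<open>T g\<close> and leaves the \<open>f\<close>-loop.\<close>

lemma T_conv:
  assumes f: "endo f" and g: "endo g"
  shows "T (conv f g) = T f * T g"
proof (rule T_eqI_op)
  show "endo (conv f g)" by (rule conv_endo) fact+
  fix W
  let ?Y = "A \<boxtimes> W"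
  have "mul W \<cdot> ((conv f g \<lhd> ?Y) \<cdot> copair W) = mul W \<cdot> (mul ?Y \<cdot> ((f \<lhd> A \<boxtimes> ?Y) \<cdot>
      ((A \<rhd> (g \<lhd> ?Y)) \<cdot> ((A \<rhd> mul ?Y) \<cdot> (copair (A \<boxtimes> ?Y) \<cdot> copair W)))))"
    using assms by (simp add: conv_op)
  also have "\<dots> = mul W \<cdot> ((A \<rhd> mul W) \<cdot> ((f \<lhd> A \<boxtimes> ?Y) \<cdot>
      ((A \<rhd> (g \<lhd> ?Y)) \<cdot> ((A \<rhd> mul ?Y) \<cdot> ((A \<rhd> A \<rhd> copair W) \<cdot> copair W)))))"
    using assms by (simp add: comp_rewrite2[OF mul_assoc] copair_nat)
  also have "\<dots> = mul W \<cdot> ((f \<lhd> ?Y) \<cdot>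
      ((A \<rhd> (mul W \<cdot> ((g \<lhd> ?Y) \<cdot> (mul ?Y \<cdot> (A \<rhd> copair W))))) \<cdot> copair W))"
    using assms by (simp add: comp_rewrite2[OF head_nat])
  also have "\<dots> = (T f * T g) \<bullet> unt W"
    using assms by (simp add: mul_copair mul_loop_left mul_loop mult.commute del: whisker_comp)
  finally show "mul W \<cdot> ((conv f g \<lhd> ?Y) \<cdot> copair W) = (T f * T g) \<bullet> unt W" .
qed

text \<open>\<open>\<epsilon>(\<kappa>\<^sub>1) \<kappa>\<^sub>2 = b(\<iota>, \<kappa>\<^sub>1)
  \<kappa>\<^sub>2 = \<iota>\<close> by the first zigzag identity.\<close>

lemma T_unit: "T (\<iota> \<cdot> \<epsilon>) = 1"
proof (rule T_eqI_op)
  fix W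
  let ?Y = "A \<boxtimes> W"
  have "mul W \<cdot> (((\<iota> \<cdot> \<epsilon>) \<lhd> ?Y) \<cdot> copair W) = mul W \<cdot> (unt ?Y \<cdot> (trc ?Y \<cdot> copair W))"
    by (simp add: unt_def trc_def)
  also have "\<dots> = trc ?Y \<cdot> copair W"
    by (simp add: comp_rewrite[OF mul_unt_left])
  also have "\<dots> = pairing ?Y \<cdot> (unt (A \<boxtimes> ?Y) \<cdot> copair W)"
    by (simp add: pairing_def comp_rewrite[OF mul_unt_left])
  also have "\<dots> = pairing ?Y \<cdot> ((A \<rhd> copair W) \<cdot> unt W)"
    by (simp add: unt_nat)
  also have "\<dots> = 1 \<bullet> unt W"
    by (simp add: comp_rewrite[OF pairing_copair])
  finally show "mul W \<cdot> (((\<iota> \<cdot> \<epsilon>) \<lhd> ?Y) \<cdot> copair W) = 1 \<bullet> unt W" .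
qed simp

text \<open>Computing \<open>f (x \<kappa>\<^sub>1) \<kappa>\<^sub>2\<close> in two ways, by \<open>x \<kappa>\<^sub>1 \<otimes> \<kappa>\<^sub>2 = \<kappa>\<^sub>1 \<otimes> \<kappa>\<^sub>2 x\<close> and by
  expanding \<open>f \<circ> m\<close>.\<close>

lemma T_ident_expansion:
  assumes f: "endo f" and fs: "\<forall>(g, h)\<in>set fs. endo g \<and> endo h"
    and expand: "f \<cdot> m = mor_sum (A \<boxtimes> A) A [m \<cdot> (g \<star> h). (g, h) \<leftarrow> fs]"
  shows "T f \<bullet> idm A = mor_sum A A [T h \<bullet> g. (g, h) \<leftarrow> fs]"
proof (rule tensored_unit_inj)
  \<comment> \<open>\<open>?F t\<close> is
    \<open>x \<mapsto> t(x \<otimes> \<kappa>\<^sub>1) \<kappa>\<^sub>2\<close>: for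
    \<open>f \<cdot> m\<close> invariance yields \<open>T f\<close>, for a summand the
    \<open>h\<close>-loop collapses.\<close>
  let ?F = "\<lambda>t. mul \<I> \<cdot> ((t \<lhd> A \<boxtimes> \<I>) \<cdot> (\<alpha>' A A (A \<boxtimes> \<I>) \<cdot> (A \<rhd> copair \<I>)))"
  have summand: "?F (m \<cdot> (g \<star> h)) = (T h \<bullet> g) \<lhd> \<I>" if g: "endo g" and h: "endo h" for g h
  proof -
    have "?F (m \<cdot> (g \<star> h)) = mul \<I> \<cdot> (mul (A \<boxtimes> \<I>) \<cdot> ((A \<rhd> (h \<lhd> A \<boxtimes> \<I>)) \<cdot> ((g \<lhd> A \<boxtimes> A \<boxtimes> \<I>) \<cdot>
          (A \<rhd> copair \<I>))))"
      using g h by (simp add: mul_def[of "A \<boxtimes> \<I>"] app2_def[of m _ _ "A \<boxtimes> \<I>"] tensor_whiskers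
          comp_rewrite2[OF assoc_inv_nat2] comp_rewrite2[OF assoc_inv_nat1])
    also have "\<dots> = mul \<I> \<cdot> ((A \<rhd> (mul \<I> \<cdot> ((h \<lhd> A \<boxtimes> \<I>) \<cdot> copair \<I>))) \<cdot> (g \<lhd> \<I>))"
      using g h by (simp add: comp_rewrite2[OF mul_assoc] head_nat)
    also have "\<dots> = (T h \<bullet> g) \<lhd> \<I>"
      using g h by (simp add: mul_loop comp_rewrite[OF mul_unt_right] del: whisker_comp)
    finally show ?thesis .
  qed
  have "(T f \<bullet> idm A) \<lhd> \<I> = mul \<I> \<cdot> ((f \<lhd> A \<boxtimes> \<I>) \<cdot> (mul (A \<boxtimes> \<I>) \<cdot> (A \<rhd> copair \<I>)))"
    using f by (simp add: mul_copair mul_loop_left)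
  also have "\<dots> = ?F (f \<cdot> m)"
    using f by (simp add: mul_def[of "A \<boxtimes> \<I>"] app2_def[of m _ _ "A \<boxtimes> \<I>"])
  also have "\<dots> = mor_sum (A \<boxtimes> \<I>) (A \<boxtimes> \<I>) (map ?F [m \<cdot> (g \<star> h). (g, h) \<leftarrow> fs])"
    unfolding expand
          by (rule mor_sum_linear) (use fs in \<open>auto simp: hom_iff tensored_plus comp_plus\<close>)
  also have "map ?F [m \<cdot> (g \<star> h). (g, h) \<leftarrow> fs] = map (\<lambda>t. t \<lhd> \<I>) [T h \<bullet> g. (g, h) \<leftarrow> fs]"
    unfolding map_map
  proof (rule map_cong)
    fix p assume "p \<in> set fs"
    then obtain g h where "p = (g, h)" "endo g" "endo h" using fs by (cases p) auto
    then show "(?F \<circ> (\<lambda>(g, h). m \<cdot> (g \<star> h))) p = ((\<lambda>t. t \<lhd> \<I>) \<circ> (\<lambda>(g, h). T h \<bullet> g)) p"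
      by (simp only: o_apply split summand)
  qed simp
  also have "mor_sum (A \<boxtimes> \<I>) (A \<boxtimes> \<I>) (map (\<lambda>t. t \<lhd> \<I>) [T h \<bullet> g. (g, h) \<leftarrow> fs]) =
        mor_sum A A [T h \<bullet> g. (g, h) \<leftarrow> fs] \<lhd> \<I>"
    by (rule mor_sum_linear[symmetric]) (use fs in \<open>auto simp: hom_iff tensored_plus\<close>)
  finally show "(T f \<bullet> idm A) \<lhd> \<I> = mor_sum A A [T h \<bullet> g. (g, h) \<leftarrow> fs] \<lhd> \<I>" .
next
  have "\<forall>t\<in>set [T h \<bullet> g. (g, h) \<leftarrow> fs]. endo t" using fs by fastforce
  then show "src (T f \<bullet> idm A) = src (mor_sum A A [T h \<bullet> g. (g, h) \<leftarrow> fs])"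
    "tgt (T f \<bullet> idm A) = tgt (mor_sum A A [T h \<bullet> g. (g, h) \<leftarrow> fs])"
    by simp_all
qed

text \<open>\<open>f\<close> expands over the last product in \<open>conv x y\<close>, which turns
  the composite into a sum of terms \<open>conv (g \<cdot> x) (h \<cdot> y)\<close>;
  \<open>T_conv\<close> applies to each.\<close>

lemma T_comp_conv:
  assumes f: "endo f" and x: "endo x" and y: "endo y"
    and fs: "\<forall>(g, h)\<in>set fs. endo g \<and> endo h"
    and expand: "f \<cdot> m = mor_sum (A \<boxtimes> A) A [m \<cdot> (g \<star> h). (g, h) \<leftarrow> fs]"
  shows "T (f \<cdot> conv x y) = (\<Sum>(g, h)\<leftarrow>fs. T (g \<cdot> x) * T (h \<cdot> y))"
proof -
  let ?F = "\<lambda>t. t \<cdot> ((x \<star> y) \<cdot> dual_mult C A m)"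
  have summand: "?F (m \<cdot> (g \<star> h)) = conv (g \<cdot> x) (h \<cdot> y)" if "endo g" "endo h" for g h
    using x y that by (simp add: conv_def tensor_comp)
  have T_gh: "endo (conv (g \<cdot> x) (h \<cdot> y))" "T (conv (g \<cdot> x) (h \<cdot> y)) = T (g \<cdot> x) * T (h \<cdot> y)"
    if "endo g" "endo h" for g h
    using x y that by (simp_all add: conv_endo T_conv)
  have "f \<cdot> conv x y = ?F (f \<cdot> m)"
    using f x y by (simp add: conv_def)
  also have "\<dots> = mor_sum A A (map ?F [m \<cdot> (g \<star> h). (g, h) \<leftarrow> fs])"
    unfolding expand by (rule mor_sum_linear) (use fs x y in \<open>auto simp: hom_iff comp_plus\<close>)
  also have "map ?F [m \<cdot> (g \<star> h). (g, h) \<leftarrow> fs] = [conv (g \<cdot> x) (h \<cdot> y). (g, h) \<leftarrow> fs]"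
    using fs summand by auto
  also have "T (mor_sum A A \<dots>) = (\<Sum>f\<leftarrow>[conv (g \<cdot> x) (h \<cdot> y). (g, h) \<leftarrow> fs]. T f)"
    by (rule T_sum) (use fs T_gh in auto)
  also have "\<dots> = (\<Sum>(g, h)\<leftarrow>fs. T (g \<cdot> x) * T (h \<cdot> y))"
    unfolding map_map by (rule arg_cong[where f = sum_list], rule map_cong) (use fs T_gh in auto)
  finally show ?thesis .
qed

end

section \<open>Integrals on Hopf algebras\<close>

definition pair_sum :: "('a \<times> 'b) list \<Rightarrow> ('a \<Rightarrow> 'b \<Rightarrow> 'v::comm_monoid_add) \<Rightarrow> 'v"
  where "pair_sum xs f = (\<Sum>(a, b)\<leftarrow>xs. f a b)"

lemma pair_sum_Nil [simp]: "pair_sum [] f = 0"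
  and pair_sum_Cons [simp]: "pair_sum ((a, b) # xs) f = f a b + pair_sum xs f"
  by (simp_all add: pair_sum_def)

lemma pair_sum_append: "pair_sum (xs @ ys) f = pair_sum xs f + pair_sum ys f"
  by (simp add: pair_sum_def)

lemma pair_sum_zero [simp]: "pair_sum xs (\<lambda>a b. 0) = 0"
  by (induction xs) auto

lemma pair_sum_add: "pair_sum xs (\<lambda>a b. f a b + g a b) = pair_sum xs f + pair_sum xs g"
  by (induction xs) (auto simp: algebra_simps)

lemma additive_pair_sum:
  fixes F :: "'v::ab_group_add \<Rightarrow> 'w::ab_group_add"
  assumes "\<And>x y. F (x + y) = F x + F y"
  shows "F (pair_sum xs f) = pair_sum xs (\<lambda>a b. F (f a b))"
proof (induction xs)
  case Nil
  show ?case using assms[of 0 0] by simp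
next
  case (Cons p xs)
  then show ?case by (cases p) (simp add: assms)
qed

lemma pair_sum_sum:
  "pair_sum xs (\<lambda>a b. \<Sum>e\<in>B. f e a b) = (\<Sum>e\<in>B. pair_sum xs (f e))"
  by (induction xs) (auto simp: sum.distrib)

text \<open>A commutative sum respects concatenation and permutation by itself, so induction on the
  congruence leaves only the relations \<open>zero\<close>, \<open>plus\<close> and
  \<open>scale\<close> to check.\<close>

lemma tensor_eq_sum_list:
  fixes F :: "'h::ab_group_add list \<Rightarrow> 'v::comm_monoid_add"
  assumes "tensor_eq scale s t"
    and zero: "\<And>u v. F (u @ [0] @ v) = 0"
    and plus: "\<And>u v a b. F (u @ [a + b] @ v) = F (u @ [a] @ v) + F (u @ [b] @ v)"
    and scale: "\<And>u v w a b c. F (u @ [scale c a] @ v @ [b] @ w) = F (u @ [a] @ v @ [scale c b] @ w)"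
  shows "(\<Sum>w\<leftarrow>s. F w) = (\<Sum>w\<leftarrow>t. F w)"
  using assms(1)
proof induction
  case (commute s t)
  show ?case by (simp add: add.commute)
qed (use zero plus scale in simp_all)

text \<open>Balanced rather than bilinear: the values lie in a mere abelian group, and scalars only
  move from one slot to the other, as in \<open>tensor_eq\<close>.\<close>

definition balanced2 where
  "balanced2 scale f \<longleftrightarrow> (\<forall>a a' b. f (a + a') b = f a b + f a' b) \<and> (\<forall>a b b'. f a (b + b') =
        f a b + f a b')
    \<and> (\<forall>c a b. f (scale c a) b = f a (scale c b))"

definition balanced3 where
  "balanced3 scale f \<longleftrightarrow> (\<forall>a a' b d. f (a + a') b d = f a b d + f a' b d) \<and>
    (\<forall>a b b' d. f a (b + b') d = f a b d + f a b' d) \<and> (\<forall>a b d d'. f a b (d + d') =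
          f a b d + f a b d')
    \<and> (\<forall>c a b d. f (scale c a) b d = f a (scale c b) d) \<and> (\<forall>c a b d. f a (scale c b) d =
          f a b (scale c d))"

lemma tensor2_eq_pair_sum:
  fixes f :: "'h::ab_group_add \<Rightarrow> 'h \<Rightarrow> 'v::ab_group_add"
  assumes "tensor2_eq scale s t" "balanced2 scale f"
  shows "pair_sum s f = pair_sum t f"
proof -
  note f = assms(2)[unfolded balanced2_def, rule_format]
  have zero: "f 0 b = 0" "f a 0 = 0" for a b
    using f by (metis add_cancel_right_left)+
  \<comment> \<open>\<open>tensor_eq\<close> speaks of words of every length; extending
    \<open>f\<close> by 0 outside length 2 respects all of its relations.\<close>
  let ?F = "\<lambda>w. case w of [a, b] \<Rightarrow> f a b | _ \<Rightarrow> 0"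
  have sum: "pair_sum s f = (\<Sum>w\<leftarrow>[[a, b]. (a, b) \<leftarrow> s]. ?F w)" for s
    by (induction s) auto
  show ?thesis
    unfolding sum
  proof (rule tensor_eq_sum_list[OF assms(1)])
    show "?F (u @ [0] @ v) = 0" for u v
      by (auto split: list.split simp: zero Cons_eq_append_conv append_eq_Cons_conv)
    show "?F (u @ [a + b] @ v) = ?F (u @ [a] @ v) + ?F (u @ [b] @ v)" for u v a b
      by (cases u; cases v) (auto split: list.split simp: f append_eq_Cons_conv)
    show "?F (u @ [scale c a] @ v @ [b] @ w) = ?F (u @ [a] @ v @ [scale c b] @ w)" for u v w a b c
      by (cases u; cases v) (auto split: list.split simp: f append_eq_Cons_conv)
  qed
qed

lemma tensor3_eq_sum_list:
  fixes f :: "'h::ab_group_add \<Rightarrow> 'h \<Rightarrow> 'h \<Rightarrow> 'v::ab_group_add"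
  assumes "tensor_eq scale s t" "balanced3 scale f"
  shows "(\<Sum>w\<leftarrow>s. case w of [a, b, d] \<Rightarrow> f a b d | _ \<Rightarrow> 0) =
        (\<Sum>w\<leftarrow>t. case w of [a, b, d] \<Rightarrow> f a b d | _ \<Rightarrow> 0)"
proof -
  note f = assms(2)[unfolded balanced3_def, rule_format]
  have zero: "f 0 b d = 0" "f a 0 d = 0" "f a b 0 = 0" for a b d
    using f by (metis add_cancel_right_left)+
  \<comment> \<open>The \<open>scale\<close> relation may also jump over the middle slot.\<close>
  have scale13: "f (scale c a) b d = f a b (scale c d)" for a b c d
    using f by simp
  let ?F = "\<lambda>w. case w of [a, b, d] \<Rightarrow> f a b d | _ \<Rightarrow> 0"
  show ?thesis
  proof (rule tensor_eq_sum_list[OF assms(1)])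
    show "?F (u @ [0] @ v) = 0" for u v
      by (auto split: list.split simp: zero Cons_eq_append_conv append_eq_Cons_conv)
    show "?F (u @ [a + b] @ v) = ?F (u @ [a] @ v) + ?F (u @ [b] @ v)" for u v a b
      by (cases u; cases "tl u"; cases v; cases "tl v") (auto split: list.split simp: f append_eq_Cons_conv)
    show "?F (u @ [scale c a] @ v @ [b] @ w) = ?F (u @ [a] @ v @ [scale c b] @ w)" for u v w a b c
      by (cases u; cases v; cases w) (auto split: list.split simp: f scale13 append_eq_Cons_conv)
  qed
qed

context hopf_algebra
begin

lemma coprod_pair_sum_plus:
  "balanced2 scale f \<Longrightarrow> pair_sum (\<delta> (g + h)) f = pair_sum (\<delta> g) f + pair_sum (\<delta> h) f"
  for f :: "'h \<Rightarrow> 'h \<Rightarrow> 'v::ab_group_add"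
  using tensor2_eq_pair_sum[OF coprod_plus] by (simp add: pair_sum_append)

lemma coprod_pair_sum_mult:
  fixes f :: "'h \<Rightarrow> 'h \<Rightarrow> 'v::ab_group_add"
  assumes "balanced2 scale f"
  shows "pair_sum (\<delta> (g * h)) f =
    pair_sum (\<delta> g) (\<lambda>a b. pair_sum (\<delta> h) (\<lambda>a' b'. f (a * a') (b * b')))"
proof -
  have inner: "pair_sum [(a * a', b * b'). (a', b') \<leftarrow> ys] f =
        pair_sum ys (\<lambda>a' b'. f (a * a') (b * b'))"
    for a b ys by (induction ys) auto
  have "pair_sum [(a * a', b * b'). (a, b) \<leftarrow> xs, (a', b') \<leftarrow> ys] f =
    pair_sum xs (\<lambda>a b. pair_sum ys (\<lambda>a' b'. f (a * a') (b * b')))" for xs ys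
    by (induction xs) (auto simp: pair_sum_append inner)
  then show ?thesis using tensor2_eq_pair_sum[OF coprod_mult assms, of g h] by simp
qed

lemma coprod_pair_sum_coassoc:
  fixes f :: "'h \<Rightarrow> 'h \<Rightarrow> 'h \<Rightarrow> 'v::ab_group_add"
  assumes "balanced3 scale f"
  shows "pair_sum (\<delta> h) (\<lambda>a b. pair_sum (\<delta> a) (\<lambda>a0 a1. f a0 a1 b)) =
    pair_sum (\<delta> h) (\<lambda>a b. pair_sum (\<delta> b) (\<lambda>b0 b1. f a b0 b1))"
proof -
  let ?F = "\<lambda>w. case w of [a, b, d] \<Rightarrow> f a b d | _ \<Rightarrow> 0"
  have "(\<Sum>w\<leftarrow>[[a0, a1, b]. (a0, a1) \<leftarrow> ys]. ?F w) = pair_sum ys (\<lambda>a0 a1. f a0 a1 b)"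
    "(\<Sum>w\<leftarrow>[[b, a0, a1]. (a0, a1) \<leftarrow> ys]. ?F w) = pair_sum ys (\<lambda>a0 a1. f b a0 a1)" for ys b
    by (induction ys) auto
  then have "(\<Sum>w\<leftarrow>[[a0, a1, b]. (a, b) \<leftarrow> xs, (a0, a1) \<leftarrow> \<delta> a]. ?F w) =
      pair_sum xs (\<lambda>a b. pair_sum (\<delta> a) (\<lambda>a0 a1. f a0 a1 b))"
    "(\<Sum>w\<leftarrow>[[a, b0, b1]. (a, b) \<leftarrow> xs, (b0, b1) \<leftarrow> \<delta> b]. ?F w) =
      pair_sum xs (\<lambda>a b. pair_sum (\<delta> b) (\<lambda>b0 b1. f a b0 b1))" for xs
    by (induction xs) (auto simp del: map_map)
  then show ?thesis using tensor3_eq_sum_list[OF coassoc assms, of h] by simp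
qed

lemma coprod_pair_sum_scale:
  fixes f :: "'h \<Rightarrow> 'h \<Rightarrow> 'v::ab_group_add"
  assumes "balanced2 scale f"
  shows "pair_sum (\<delta> (scale c h)) f = pair_sum (\<delta> h) (\<lambda>a b. f (scale c a) b)"
proof -
  have "pair_sum [(scale c a, b). (a, b) \<leftarrow> xs] f = pair_sum xs (\<lambda>a b. f (scale c a) b)" for xs
    by (induction xs) auto
  then show ?thesis using tensor2_eq_pair_sum[OF coprod_scale assms, of c h] by simp
qed

end

text \<open>The axiom \<open>integral\<close> means that in the dual algebra the product of any
  functional \<open>f\<close> with \<open>l\<close> is \<open>f 1\<close> times \<open>l\<close>.
  \<open>l_one\<close> permits an elementary proof of non-degeneracy.\<close>

locale hopf_integral = hopf_algebra scale \<delta> counit antipode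
  for scale :: "'k::field \<Rightarrow> 'h::ring_1 \<Rightarrow> 'h" and \<delta> counit antipode +
  fixes l :: "'h \<Rightarrow> 'k"
  assumes l_plus: "l (g + h) = l g + l h" and l_scale: "l (scale c h) = c * l h"
    and integral: "pair_sum (\<delta> h) (\<lambda>a b. scale (l b) a) = scale (l h) 1"
    and l_one: "l 1 \<noteq> 0"
begin


lemma antipode_plus: "antipode (a + b) = antipode a + antipode b"
  and antipode_scale: "antipode (scale c a) = scale c (antipode a)"
  using antipode_linear by (simp_all add: Vector_Spaces.linear_iff)

lemmas linear_simps =
      l_plus l_scale antipode_plus antipode_scale scale_left_distrib scale_right_distrib
  distrib_left distrib_right scale_mult_left scale_mult_right

text \<open>Apply \<open>integral\<close> to the product: \<open>l(h\<^sub>1 g) 1 = h\<^sub>1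
  g\<^sub>0 l(h\<^sub>2 g\<^sub>1)\<close>. The antipode of \<open>h\<^sub>0\<close> in front then
  contracts with \<open>h\<^sub>1\<close>, and the counit axiom restores \<open>h\<close>.\<close>

lemma antipode_integral:
  "pair_sum (\<delta> h) (\<lambda>a b. scale (l (b * g)) (antipode a)) =
        pair_sum (\<delta> g) (\<lambda>a b. scale (l (h * b)) a)"
proof -
  let ?f = "\<lambda>a b0 b1. pair_sum (\<delta> g) (\<lambda>g0 g1. scale (l (b1 * g1)) (antipode a * b0 * g0))"
  have "scale (l (b * g)) (antipode a) = pair_sum (\<delta> b) (\<lambda>b0 b1. ?f a b0 b1)" for a b
  proof -
    have "scale (l (b * g)) (antipode a) = antipode a * pair_sum (\<delta> (b * g)) (\<lambda>x y. scale (l y) x)"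
      by (simp add: integral scale_mult_right)
    also have "pair_sum (\<delta> (b * g)) (\<lambda>x y. scale (l y) x) =
        pair_sum (\<delta> b) (\<lambda>b0 b1. pair_sum (\<delta> g) (\<lambda>g0 g1. scale (l (b1 * g1)) (b0 * g0)))"
      by (rule coprod_pair_sum_mult) (simp add: balanced2_def linear_simps mult.commute)
    also have "antipode a * \<dots> = pair_sum (\<delta> b) (\<lambda>b0 b1. ?f a b0 b1)"
      by (simp add: additive_pair_sum[of "(*) (antipode a)"] linear_simps mult.assoc)
    finally show ?thesis .
  qed
  then have "pair_sum (\<delta> h) (\<lambda>a b. scale (l (b * g)) (antipode a)) =
      pair_sum (\<delta> h) (\<lambda>a b. pair_sum (\<delta> b) (\<lambda>b0 b1. ?f a b0 b1))"
    by simp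
  also have "\<dots> = pair_sum (\<delta> h) (\<lambda>a b. pair_sum (\<delta> a) (\<lambda>a0 a1. ?f a0 a1 b))"
    by (rule coprod_pair_sum_coassoc[symmetric])
      (simp add: balanced3_def linear_simps pair_sum_add mult.commute)
  also have "\<dots> =
        pair_sum (\<delta> h) (\<lambda>a b. pair_sum (\<delta> g) (\<lambda>g0 g1. scale (l (scale (counit a) b * g1)) g0))"
  proof -
    have "pair_sum (\<delta> a) (\<lambda>a0 a1. ?f a0 a1 b) =
        pair_sum (\<delta> g) (\<lambda>g0 g1. scale (l (scale (counit a) b * g1)) g0)" for a b
    proof -
      let ?G = "\<lambda>x. pair_sum (\<delta> g) (\<lambda>g0 g1. scale (l (b * g1)) (x * g0))"
      have "pair_sum (\<delta> a) (\<lambda>a0 a1. ?f a0 a1 b) = ?G (pair_sum (\<delta> a) (\<lambda>a0 a1. antipode a0 * a1))"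
        by (rule additive_pair_sum[symmetric]) (simp add: linear_simps pair_sum_add)
      also have "pair_sum (\<delta> a) (\<lambda>a0 a1. antipode a0 * a1) = scale (counit a) 1"
        using antipode_left by (simp add: pair_sum_def)
      finally show ?thesis by (simp add: linear_simps mult.commute)
    qed
    then show ?thesis by simp
  qed
  also have "\<dots> = pair_sum (\<delta> g) (\<lambda>a b. scale (l (pair_sum (\<delta> h) (\<lambda>a b. scale (counit a) b) * b)) a)"
    by (rule additive_pair_sum[symmetric]) (simp add: linear_simps pair_sum_add)
  also have "pair_sum (\<delta> h) (\<lambda>a b. scale (counit a) b) = h"
    using counit_left by (simp add: pair_sum_def)
  finally show ?thesis .
qed

text \<open>The proof rests on \<open>l 1 \<bullet> g = \<Sum> l (S g\<^sub>1 g\<^sub>2) \<bullet> g\<^sub>0\<close>: by \<open>antipode_integral\<close> the sums \<open>\<Sum> l (h g\<^sub>1) \<bullet> g\<^sub>0\<close> vanish for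
  every \<open>h\<close>. As \<open>S g\<^sub>1\<close> is not a constant \<open>h\<close>, it is first expanded in the basis \<open>B\<close>.\<close>

lemma integral_nondegenerate:
  assumes "finite_dimensional_vector_space scale B" and deg: "\<And>h. l (h * g) = 0"
  shows "g = 0"
proof -
  interpret fd: finite_dimensional_vector_space scale B by fact
  note rep = representation_add[OF fd.independent_Basis] representation_scale[OF fd.independent_Basis]
    fd.span_Basis
  have expand: "(\<Sum>e\<in>B. scale (representation B v e) e) = v" for v
    by (rule sum_representation_eq[OF fd.independent_Basis])
      (simp_all add: fd.span_Basis fd.finite_Basis)
  have zero: "pair_sum (\<delta> g) (\<lambda>a b. scale (l (h * b)) a) = 0" for h
    unfolding antipode_integral[symmetric] by (simp add: deg)
  \<comment> \<open>\<open>?F e a\<close> weights \<open>a\<^sub>0\<close> with the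
    \<open>e\<close>-coordinate of the antipode of \<open>a\<^sub>1\<close>. Being linear in
    \<open>a\<close>, it can be pulled out of the sum over \<open>\<delta> g\<close>, where
    \<open>zero\<close> applies.\<close>
  let ?F = "\<lambda>e a. pair_sum (\<delta> a) (\<lambda>x y. scale (representation B (antipode y) e) x)"
  have bal: "balanced2 scale (\<lambda>x y. scale (representation B (antipode y) e) x)" for e
    by (simp add: balanced2_def linear_simps rep mult.commute)
  have F_plus: "?F e (a + b) = ?F e a + ?F e b" for e a b
    by (rule coprod_pair_sum_plus) (rule bal)
  have F_zero: "?F e 0 = 0" for e
    using F_plus[of 0 0 e] by simp
  have F_scale: "?F e (scale c a) = scale c (?F e a)" for e c a
    by (simp add: coprod_pair_sum_scale[OF bal] additive_pair_sum[of "scale c"] linear_simps mult.commute)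
  have "scale (l 1) g = scale (l 1) (pair_sum (\<delta> g) (\<lambda>a b. scale (counit b) a))"
    using counit_right by (simp add: pair_sum_def)
  also have "\<dots> = pair_sum (\<delta> g) (\<lambda>a b. scale (l (scale (counit b) 1)) a)"
    by (simp add: additive_pair_sum[of "scale (l 1)"] linear_simps mult.commute)
  also have "\<dots> = pair_sum (\<delta> g) (\<lambda>a b. pair_sum (\<delta> b) (\<lambda>x y. scale (l (antipode x * y)) a))"
  proof -
    have "scale (l (scale (counit b) 1)) a =
          pair_sum (\<delta> b) (\<lambda>x y. scale (l (antipode x * y)) a)" for a b
      unfolding antipode_left[of b, symmetric, folded pair_sum_def]
      by (rule additive_pair_sum) (simp add: linear_simps)
    then show ?thesis by simp
  qed
  also have "\<dots> = pair_sum (\<delta> g) (\<lambda>a b. pair_sum (\<delta> a) (\<lambda>x y. scale (l (antipode y * b)) x))"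
    by (rule coprod_pair_sum_coassoc[symmetric]) (simp add: balanced3_def linear_simps mult.commute)
  also have "\<dots> = pair_sum (\<delta> g) (\<lambda>a b. \<Sum>e\<in>B. ?F e (scale (l (e * b)) a))"
  proof -
    have "scale (l (antipode y * b)) x =
          (\<Sum>e\<in>B. scale (l (e * b)) (scale (representation B (antipode y) e) x))"
      for x y b
    proof -
      have "l (antipode y * b) = (\<Sum>e\<in>B. representation B (antipode y) e * l (e * b))"
      proof -
        have "l (v * b) = (\<Sum>e\<in>E. c e * l (e * b))" if "v = (\<Sum>e\<in>E. scale (c e) e)" for v E c
        proof -
          have "l 0 = 0" using l_scale[of 0 0] by simp
          then have "l ((\<Sum>e\<in>E. scale (c e) e) * b) = (\<Sum>e\<in>E. c e * l (e * b))"
            by (induction E rule: infinite_finite_induct) (auto simp: linear_simps)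
          then show ?thesis using that by simp
        qed
        then show ?thesis using expand[of "antipode y"] by metis
      qed
      then show ?thesis by (simp add: scale_sum_left mult.commute)
    qed
    then have "pair_sum (\<delta> a) (\<lambda>x y. scale (l (antipode y * b)) x) =
          (\<Sum>e\<in>B. ?F e (scale (l (e * b)) a))" for a b
      by (simp add: pair_sum_sum F_scale additive_pair_sum[of "scale _"] linear_simps)
    then show ?thesis by simp
  qed
  also have "\<dots> = (\<Sum>e\<in>B. ?F e (pair_sum (\<delta> g) (\<lambda>a b. scale (l (e * b)) a)))"
    by (simp add: pair_sum_sum additive_pair_sum[of "?F _"] F_plus)
  also have "\<dots> = 0"
    by (simp add: zero F_zero)
  finally show "g = 0" using l_one by simp
qed

lemma integral_onto_dual:
  assumes fin: "finite_dimensional_vector_space scale B" and L: "Vector_Spaces.linear scale (*) L"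
  shows "\<exists>g. \<forall>h. L h = l (h * g)"
proof -
  interpret fd: finite_dimensional_vector_space scale B by fact
  have L_lin: "L (a + b) = L a + L b" "L (scale c a) = c * L a" for a b c
    using L by (simp_all add: Vector_Spaces.linear_iff)
  \<comment> \<open>\<open>B\<close> identifies functionals with vectors of the same coordinates, so
    \<open>g \<mapsto> l(- g)\<close> becomes an endomorphism \<open>?P\<close> of \<open>H\<close>,
    for which injectivity gives surjectivity.\<close>
  let ?P = "\<lambda>g. \<Sum>e\<in>B. scale (l (e * g)) e"
  have unique: "\<forall>e\<in>B. c e = d e" if "(\<Sum>e\<in>B. scale (c e) e) = (\<Sum>e\<in>B. scale (d e) e)" for c d
  proof -
    have "(\<Sum>e\<in>B. scale (c e - d e) e) = 0"
      using that by (simp add: scale_left_diff_distrib sum_subtractf)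
    then show ?thesis
      using independentD[OF fd.independent_Basis fd.finite_Basis subset_refl, where u =
        "\<lambda>e. c e - d e"]
      by simp
  qed
  have ext: "f = (\<lambda>h. 0)" if "\<And>a b. f (a + b) = f a + f b" "\<And>c a. f (scale c a) = c * f a" "\<forall>e\<in>B. f e = 0"
    for f :: "'h \<Rightarrow> 'k"
  proof
    fix h
    have "h \<in> span B" by (simp add: fd.span_Basis)
    then show "f h = 0"
    proof (induction rule: span_induct_alt)
      case base
      show ?case using that(2)[of 0 0] by simp
    next
      case (step c x y)
      then show ?case using that by simp
    qed
  qed
  have "Vector_Spaces.linear scale scale ?P"
    by (simp add: Vector_Spaces.linear_iff linear_simps sum.distrib scale_sum_right vector_space_axioms)
  moreover have "inj ?P"
  proof (rule injI)
    fix g g' assume "?P g = ?P g'"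
    then have "\<forall>e\<in>B. l (e * g) = l (e * g')" by (rule unique)
    then have "(\<lambda>h. l (h * g) - l (h * g')) = (\<lambda>h. 0)"
      by (intro ext) (simp_all add: distrib_right l_plus scale_mult_left l_scale right_diff_distrib)
    moreover have "l (h * (g - g')) = l (h * g) - l (h * g')" for h
      using l_plus[of "h * (g - g')" "h * g'"] by (simp add: algebra_simps)
    ultimately have "l (h * (g - g')) = 0" for h
      by (simp add: fun_eq_iff)
    then have "g - g' = 0" by (rule integral_nondegenerate[OF fin])
    then show "g = g'" by simp
  qed
  ultimately have "surj ?P" by (rule fd.linear_inj_imp_surj)
  then have "(\<Sum>e\<in>B. scale (L e) e) \<in> range ?P" by simp
  then obtain g where "(\<Sum>e\<in>B. scale (L e) e) = ?P g" by (rule rangeE)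
  then have "\<forall>e\<in>B. L e = l (e * g)" by (rule unique)
  then have "(\<lambda>h. l (h * g) - L h) = (\<lambda>h. 0)"
    by (intro ext) (simp_all add: distrib_right l_plus scale_mult_left l_scale L_lin right_diff_distrib)
  then show ?thesis by (intro exI[of _ g]) (simp add: fun_eq_iff)
qed

end

section \<open>The epimorphism onto the dual\<close>

text \<open>Elimination of one generator of the hom-space at a time: within a subspace, the vectors
  whose image can be written without that generator have codimension at most one.\<close>

lemma (in k_linear_category) finite_dim_of_embedding:
  fixes scale :: "'k \<Rightarrow> 'h::ab_group_add \<Rightarrow> 'h"
  assumes "vector_space scale" and "inj \<rho>" and hom: "range \<rho> \<subseteq> hom_set C X Y"
    and plus: "\<And>g h. \<rho> (g + h) = \<rho> g \<boxplus> \<rho> h" and scale: "\<And>c h. \<rho> (scale c h) = c \<bullet> \<rho> h"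
    and fin: "finite_dim_module (hom_space C X Y)"
  shows "finite_dim_space scale"
proof -
  interpret V: vector_space scale by fact
  interpret M: Module.module ground_ring "hom_space C X Y" by (rule hom_vector_space)
  let ?M = "hom_space C X Y"
  define comb where "comb B c = (\<Oplus>\<^bsub>?M\<^esub>b\<in>B. c b \<odot>\<^bsub>?M\<^esub> b)" for B c
  have \<rho>: "\<rho> h \<in> carrier ?M" for h using hom by (auto simp: hom_space_def)
  have lin: "\<rho> (g + h) = \<rho> g \<oplus>\<^bsub>?M\<^esub> \<rho> h" "\<rho> (scale c h) = c \<odot>\<^bsub>?M\<^esub> \<rho> h" for c g h
    using plus scale by (simp_all add: hom_space_def)
  have gr: "c \<in> carrier ground_ring" "c \<oplus>\<^bsub>ground_ring\<^esub> d = c + d" "c \<otimes>\<^bsub>ground_ring\<^esub> d = c * d"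
    "\<zero>\<^bsub>ground_ring\<^esub> = 0" for c d :: 'k
    by (simp_all add: ground_ring_def)
  have \<rho>0: "\<rho> 0 = \<zero>\<^bsub>?M\<^esub>"
    using lin(2)[of 0 0] M.smult_l_null[OF \<rho>[of 0]] by (simp add: gr)
  have comb_closed: "comb B c \<in> carrier ?M" if "B \<subseteq> carrier ?M" for B c
    using that unfolding comb_def by (intro M.finsum_closed) (auto intro!: M.smult_closed simp: gr)
  have comb_add: "comb B c \<oplus>\<^bsub>?M\<^esub> comb B d = comb B (\<lambda>b. c b + d b)" if "B \<subseteq> carrier ?M" for B c d
    unfolding comb_def
  proof -
    have "(\<Oplus>\<^bsub>?M\<^esub>b\<in>B. (c b + d b) \<odot>\<^bsub>?M\<^esub> b) = (\<Oplus>\<^bsub>?M\<^esub>b\<in>B. c b \<odot>\<^bsub>?M\<^esub> b \<oplus>\<^bsub>?M\<^esub> d b \<odot>\<^bsub>?M\<^esub> b)"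
      using that M.smult_l_distr
        by (intro M.finsum_cong') (auto intro!: M.smult_closed simp: gr subset_iff)
    also have "\<dots> = (\<Oplus>\<^bsub>?M\<^esub>b\<in>B. c b \<odot>\<^bsub>?M\<^esub> b) \<oplus>\<^bsub>?M\<^esub> (\<Oplus>\<^bsub>?M\<^esub>b\<in>B. d b \<odot>\<^bsub>?M\<^esub> b)"
      using that by (intro M.finsum_addf) (auto intro!: M.smult_closed simp: gr)
    finally show "(\<Oplus>\<^bsub>?M\<^esub>b\<in>B. c b \<odot>\<^bsub>?M\<^esub> b) \<oplus>\<^bsub>?M\<^esub> (\<Oplus>\<^bsub>?M\<^esub>b\<in>B. d b \<odot>\<^bsub>?M\<^esub> b) =
      (\<Oplus>\<^bsub>?M\<^esub>b\<in>B. (c b + d b) \<odot>\<^bsub>?M\<^esub> b)" by (rule HOL.sym)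
  qed
  have comb_scale: "a \<odot>\<^bsub>?M\<^esub> comb B c = comb B (\<lambda>b. a * c b)" if "finite B" "B \<subseteq> carrier ?M" for a B c
  proof -
    have "a \<odot>\<^bsub>?M\<^esub> comb B c = (\<Oplus>\<^bsub>?M\<^esub>b\<in>B. a \<odot>\<^bsub>?M\<^esub> (c b \<odot>\<^bsub>?M\<^esub> b))"
      using that unfolding comb_def
        by (intro M.finsum_smult_ldistr) (auto intro!: M.smult_closed simp: gr)
    also have "\<dots> = comb B (\<lambda>b. a * c b)"
      using that M.smult_assoc1 unfolding comb_def
        by (intro M.finsum_cong') (auto intro!: M.smult_closed simp: gr subset_iff)
    finally show ?thesis .
  qed
  have main: "\<exists>F. finite F \<and> S \<subseteq> V.span F"
    if "finite B" "B \<subseteq> carrier ?M" "V.subspace S" "\<forall>s\<in>S. \<exists>c. \<rho> s = comb B c" for B S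
    using that
  proof (induction B arbitrary: S rule: finite_induct)
    case empty
    have "s = 0" if "s \<in> S" for s
      using empty that \<rho>0 \<open>inj \<rho>\<close> by (auto simp: inj_def comb_def)
    then have "S \<subseteq> V.span {}" by auto
    then show ?case by blast
  next
    case (insert b B)
    have B: "B \<subseteq> carrier ?M" and b: "b \<in> carrier ?M" using insert.prems by auto
    have comb_insert: "comb (insert b B) c = c b \<odot>\<^bsub>?M\<^esub> b \<oplus>\<^bsub>?M\<^esub> comb B c" for c
      using insert.hyps B b unfolding comb_def
        by (intro M.finsum_insert) (auto intro!: M.smult_closed simp: gr)
    let ?S = "{s \<in> S. \<exists>c. \<rho> s = comb B c}"
    have "V.subspace ?S"
    proof (rule V.subspaceI)
      \<comment> \<open>Zero is written with coefficients \<open>0 * 0\<close> so that it arises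
        from \<open>comb_scale\<close> as 0 times a combination.\<close>
      have "\<rho> 0 = comb B (\<lambda>_. 0 * 0)"
        unfolding comb_scale[OF insert.hyps(1) B, symmetric]
        using M.smult_l_null[OF comb_closed[OF B]] by (simp add: \<rho>0 gr)
      then have "\<exists>c. \<rho> 0 = comb B c" by (rule exI[of _ "\<lambda>_. 0 * 0"])
      then show "0 \<in> ?S" using V.subspace_0[OF insert.prems(2)] by blast
      show "x + y \<in> ?S" if xy: "x \<in> ?S" "y \<in> ?S" for x y
      proof -
        from xy obtain c d where "\<rho> x = comb B c" "\<rho> y = comb B d" by blast
        then have "\<rho> (x + y) = comb B (\<lambda>b. c b + d b)" by (simp only: lin comb_add[OF B])
        then have "\<exists>c. \<rho> (x + y) = comb B c" by blast
        then show ?thesis using xy V.subspace_add[OF insert.prems(2), of x y] by simp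
      qed
      show "scale a x \<in> ?S" if x: "x \<in> ?S" for a x
      proof -
        from x obtain c where c: "\<rho> x = comb B c" by blast
        have "\<rho> (scale a x) = comb B (\<lambda>b. a * c b)"
          unfolding lin c by (rule comb_scale[OF insert.hyps(1) B])
        then have "\<exists>c. \<rho> (scale a x) = comb B c" by blast
        then show ?thesis using x V.subspace_scale[OF insert.prems(2), of x a] by simp
      qed
    qed
    moreover have "\<forall>s\<in>?S. \<exists>c. \<rho> s = comb B c" by simp
    ultimately have "\<exists>F. finite F \<and> ?S \<subseteq> V.span F" by (rule insert.IH[OF B])
    then obtain F where F: "finite F" "?S \<subseteq> V.span F" by (elim exE conjE)
    show ?case
    proof (cases "S \<subseteq> ?S")
      case True
      then show ?thesis using F by blast
    next
      case False
      then obtain s0 where s0: "s0 \<in> S" "s0 \<notin> ?S" by blast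
      then obtain c0 where c0: "\<rho> s0 = comb (insert b B) c0" using insert.prems(3) by blast
      have "c0 b \<noteq> 0"
      proof
        assume "c0 b = 0"
        then have "\<rho> s0 = comb B c0"
          using c0 M.smult_l_null[OF b] comb_closed[OF B] by (simp add: comb_insert gr)
        then have "\<exists>c. \<rho> s0 = comb B c" by blast
        then show False using s0 by simp
      qed
      have "s \<in> V.span (insert s0 F)" if s: "s \<in> S" for s
      proof -
        obtain c where c: "\<rho> s = comb (insert b B) c" using insert.prems(3) s by blast
        \<comment> \<open>Chosen so that the coefficient of \<open>b\<close> cancels in
          \<open>\<rho> (s + scale k s0)\<close>.\<close>
        define k where "k = - c b / c0 b"
        have bB: "insert b B \<subseteq> carrier ?M" using b B by blast
        have "\<rho> (s + scale k s0) = comb (insert b B) (\<lambda>x. c x + k * c0 x)"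
          using insert.hyps(1) by (simp add: lin c c0 comb_add[OF bB] comb_scale[OF _ bB])
        also have "\<dots> = comb B (\<lambda>x. c x + k * c0 x)"
          using \<open>c0 b \<noteq> 0\<close> M.smult_l_null[OF b] comb_closed[OF B]
            by (simp add: comb_insert gr k_def)
        finally have "\<exists>c. \<rho> (s + scale k s0) = comb B c" by blast
        then have "s + scale k s0 \<in> ?S"
          using V.subspace_add[OF insert.prems(2) s V.subspace_scale[OF insert.prems(2) s0(1)]] by simp
        then have "s + scale k s0 \<in> V.span (insert s0 F)"
          using F(2) V.span_mono[of F "insert s0 F"] by blast
        then have "(s + scale k s0) - scale k s0 \<in> V.span (insert s0 F)"
          by (rule V.span_diff) (simp add: V.span_scale V.span_base)
        then show ?thesis by simp
      qed
      then show ?thesis using F(1) by (intro exI[of _ "insert s0 F"]) auto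
    qed
  qed
  obtain B where "finite B" "B \<subseteq> carrier ?M" "\<forall>x\<in>carrier ?M. \<exists>c. x = comb B c"
    using fin unfolding finite_dim_module_def comb_def by blast
  with main[of B UNIV] \<rho> obtain F where F: "finite F" "UNIV \<subseteq> V.span F"
    by (auto simp: V.subspace_UNIV)
  obtain E where E: "E \<subseteq> F" "V.independent E" "V.span E = V.span F"
    using V.maximal_independent_subset[of F] V.span_mono V.span_eq
    by (metis V.span_span subset_antisym)
  have "finite_dimensional_vector_space scale E"
    using E F finite_subset
    by (intro finite_dimensional_vector_space.intro finite_dimensional_vector_space_axioms.intro
        V.vector_space_axioms) auto
  then show ?thesis unfolding finite_dim_space_def by blast
qed

section \<open>The action and the map onto the dual\<close>

locale hopf_action_on_algebra =
  connected_separable_algebra C A m \<iota> + hopf_algebra scale \<delta> counit antipode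
  for C :: "('o, 'm, 'k::field, 'z) spherical_data_scheme" (structure) and A m \<iota>
    and scale :: "'k \<Rightarrow> 'h::ring_1 \<Rightarrow> 'h" and \<delta> counit antipode +
  fixes \<rho> :: "'h \<Rightarrow> 'm"
  assumes action: "hopf_action C A m \<iota> scale \<delta> counit \<rho>" and faithful: "inj \<rho>"
begin

lemma \<rho>_range: "range \<rho> \<subseteq> hom_set C A A"
  using action by (simp add: hopf_action_def)

lemma \<rho>_hom [simp]: "src (\<rho> h) = A" "tgt (\<rho> h) = A"
  using \<rho>_range by (auto simp: image_subset_iff hom_iff)

lemma \<rho>_plus: "\<rho> (g + h) = \<rho> g \<boxplus> \<rho> h" and \<rho>_scale: "\<rho> (scale c h) = c \<bullet> \<rho> h"
  and \<rho>_one: "\<rho> 1 = idm A" and \<rho>_mult: "\<rho> (g * h) = \<rho> g \<cdot> \<rho> h"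
  and \<rho>_counit: "\<rho> h \<cdot> \<iota> = counit h \<bullet> \<iota>"
  using action by (simp_all add: hopf_action_def)

definition coprod_act where "coprod_act h = [(\<rho> a, \<rho> b). (a, b) \<leftarrow> \<delta> h]"

lemma \<rho>_mul: "\<rho> h \<cdot> m = mor_sum (A \<boxtimes> A) A [m \<cdot> (g \<star> k). (g, k) \<leftarrow> coprod_act h]"
  using action by (simp add: hopf_action_def coprod_act_def case_prod_beta' comp_def)

lemma coprod_act_endo: "\<forall>(g, k)\<in>set (coprod_act h). endo g \<and> endo k"
  by (auto simp: coprod_act_def)

definition \<gamma> where "\<gamma> x h = T (\<rho> h \<cdot> x)"

lemma \<gamma>_linear: "endo x \<Longrightarrow> Vector_Spaces.linear scale (*) (\<gamma> x)"
  by (simp add: \<gamma>_def Vector_Spaces.linear_iff \<rho>_plus \<rho>_scale comp_plus T_linear vector_space_axioms)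
    (unfold_locales; simp add: algebra_simps)

lemma \<gamma>_conv:
  assumes "endo x" "endo y"
  shows "\<gamma> (conv x y) h = (\<Sum>(a, b)\<leftarrow>\<delta> h. \<gamma> x a * \<gamma> y b)"
proof -
  have "\<gamma> (conv x y) h = (\<Sum>(g, k)\<leftarrow>coprod_act h. T (g \<cdot> x) * T (k \<cdot> y))"
    unfolding \<gamma>_def using assms coprod_act_endo \<rho>_mul by (intro T_comp_conv) auto
  then show ?thesis by (simp add: coprod_act_def \<gamma>_def case_prod_beta' comp_def)
qed

lemma \<gamma>_one: "\<gamma> (\<iota> \<cdot> \<epsilon>) = counit"
proof
  fix h
  have "\<rho> h \<cdot> (\<iota> \<cdot> \<epsilon>) = counit h \<bullet> (\<iota> \<cdot> \<epsilon>)"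
    using \<rho>_counit[of h] by (simp add: comp_rewrite[OF \<rho>_counit])
  then show "\<gamma> (\<iota> \<cdot> \<epsilon>) h = counit h"
    by (simp add: \<gamma>_def T_linear T_unit)
qed

lemma \<rho>_zero: "\<rho> 0 = zero_mor C A A"
  using \<rho>_scale[of 0 0] by (simp add: scale_zero)

text \<open>\<open>T_ident_expansion\<close> for \<open>\<rho> h\<close> is this identity after
  applying \<open>\<rho>\<close>, which is injective.\<close>

lemma T_integral: "pair_sum (\<delta> h) (\<lambda>a b. scale (T (\<rho> b)) a) = scale (T (\<rho> h)) 1"
proof -
  have sum: "\<rho> (pair_sum xs (\<lambda>a b. scale (T (\<rho> b)) a)) =
      mor_sum A A [T k \<bullet> g. (g, k) \<leftarrow> [(\<rho> a, \<rho> b). (a, b) \<leftarrow> xs]]" for xs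
    by (induction xs) (auto simp: \<rho>_zero \<rho>_plus \<rho>_scale)
  have "\<rho> (scale (T (\<rho> h)) 1) = \<rho> (pair_sum (\<delta> h) (\<lambda>a b. scale (T (\<rho> b)) a))"
    using T_ident_expansion[OF _ coprod_act_endo \<rho>_mul, of h]
    by (simp add: sum coprod_act_def \<rho>_scale \<rho>_one)
  then show ?thesis using faithful by (simp add: inj_def)
qed

sublocale hopf_integral scale \<delta> counit antipode "\<lambda>h. T (\<rho> h)"
  by unfold_locales
    (simp_all add: \<rho>_plus \<rho>_scale \<rho>_one T_linear T_integral T_ident_nonzero)

lemma \<gamma>_onto:
  assumes "finite_dim_space scale" "Vector_Spaces.linear scale (*) L"
  shows "\<exists>x. endo x \<and> \<gamma> x = L"
proof -
  obtain g where "\<forall>h. L h = T (\<rho> (h * g))"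
    using assms integral_onto_dual unfolding finite_dim_space_def by blast
  then have "\<gamma> (\<rho> g) = L" by (auto simp: \<gamma>_def \<rho>_mult)
  then show ?thesis by (intro exI[of _ "\<rho> g"]) simp
qed

lemma \<gamma>_epi:
  assumes "finite_dim_space scale"
  shows "algebra_epi (convolution_algebra C A m \<iota>) (dual_algebra scale \<delta> counit) \<gamma>"
  unfolding algebra_epi_def
proof (intro conjI)
  show "\<gamma> \<in> ring_hom (convolution_algebra C A m \<iota>) (dual_algebra scale \<delta> counit)"
    using \<gamma>_one \<gamma>_conv
    by (intro ring_hom_memI)
      (auto simp: convolution_algebra_def dual_algebra_def hom_space_def hom_iff conv_def \<epsilon>_def
        \<gamma>_linear \<gamma>_def[of "_ \<boxplus> _"] comp_plus T_linear \<gamma>_def fun_eq_iff)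
  show "\<forall>c. \<forall>x\<in>carrier (convolution_algebra C A m \<iota>).
      \<gamma> (c \<odot>\<^bsub>convolution_algebra C A m \<iota>\<^esub> x) = c \<odot>\<^bsub>dual_algebra scale \<delta> counit\<^esub> \<gamma> x"
    by (auto simp: convolution_algebra_def dual_algebra_def hom_space_def hom_iff \<gamma>_def T_linear)
  show "\<gamma> ` carrier (convolution_algebra C A m \<iota>) = carrier (dual_algebra scale \<delta> counit)"
    using \<gamma>_linear \<gamma>_onto[OF assms]
    by (force simp: convolution_algebra_def dual_algebra_def hom_space_def hom_iff)
qed

end

theorem proposition5:
  fixes C :: "('o, 'm, 'k::{alg_closed_field, field_char_0}) spherical_data"
    and A :: 'o and m \<iota> :: 'm
    and scale :: "'k \<Rightarrow> 'h::ring_1 \<Rightarrow> 'h"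
    and \<delta> :: "'h \<Rightarrow> ('h \<times> 'h) list"
    and counit :: "'h \<Rightarrow> 'k" and antipode :: "'h \<Rightarrow> 'h"
    and \<rho> :: "'h \<Rightarrow> 'm"
  assumes "spherical_tensor_category C"
    and "separable_algebra C A m \<iota>"
    and "connected_algebra C A \<iota>"
    and "hopf_algebra scale \<delta> counit antipode"
    and "hopf_action C A m \<iota> scale \<delta> counit \<rho>"
    and "inj \<rho>"
    and "finite_dim_module (hom_space C A A) \<or> finite_dim_space scale"
  shows "\<exists>\<gamma>. algebra_epi (convolution_algebra C A m \<iota>) (dual_algebra scale \<delta> counit) \<gamma>"
proof -
  interpret connected_separable_algebra C A m \<iota>
    using assms(1-3)
          by (intro connected_separable_algebra.intro connected_separable_algebra_axioms.intro)
  interpret hopf_action_on_algebra C A m \<iota> scale \<delta> counit antipode \<rho>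
    using assms(4-6) connected_separable_algebra_axioms
    by (intro hopf_action_on_algebra.intro hopf_action_on_algebra_axioms.intro)
  \<comment> \<open>In the first alternative faithfulness embeds \<open>H\<close> into the
    finite-dimensional space \<open>C(A, A)\<close>.\<close>
  have "finite_dim_space scale"
    using assms(7) finite_dim_of_embedding[OF vector_space_axioms faithful \<rho>_range \<rho>_plus \<rho>_scale]
    by blast
  then show ?thesis using \<gamma>_epi by blast
qed

end
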